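(* Let $\alpha,\beta\in\Gamma$ be given and let the Weak Atkinson condition hold. Then the imaginary part of the Weyl--Titchmarsh function $M_{N+1}(\lambda)$ admits the integral representation $$\operatorname{Im}M_{N+1}(\lambda)=\operatorname{Im}(\lambda)\,M^{[1]}+\int_{-\infty}^\infty\operatorname{Im}\big((t-\lambda)^{-1}\big)\,\mathrm d\tau_{\alpha,\beta}(t)\qquad\text{for all }\lambda\in\mathbb C\setminus\mathbb R,$$ where $M^{[1]}:=\lim_{\mu\to\infty}M_{N+1}(i\mu)/(i\mu)\ge0$. Consequently, $$M_{N+1}(\lambda)=M^{[0]}+\lambda M^{[1]}+\int_{-\infty}^\infty\Big(\frac1{t-\lambda}-\frac t{1+t^2}\Big)\,\mathrm d\tau_{\alpha,\beta}(t)\qquad\text{for all }\lambda\in\mathbb C\setminus\mathbb R,$$ where $M^{[0]}:=\operatorname{Re}M_{N+1}(i)$.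
   Context: Setting: $n\in\mathbb N$, $N\in\{0,1,2,\dots\}$, $\mathcal I_{\mathbb Z}=[0,N]\cap\mathbb Z$, $\mathcal I_{\mathbb Z}^+=[0,N+1]\cap\mathbb Z$, $\mathcal J=\begin{pmatrix}0&-I_n\\ I_n&0\end{pmatrix}$. For all $k\in\mathcal I_{\mathbb Z}$, $\mathcal S_k,\Psi_k\in\mathbb C^{2n\times2n}$ satisfy $\mathcal S_k^*\mathcal J\mathcal S_k=\mathcal J$, $\Psi_k^*=\Psi_k$, $\Psi_k^*\mathcal J\Psi_k=0$, $\Psi_k\ge0$; put $\mathcal V_k=-\mathcal J\Psi_k\mathcal S_k$ and $\mathbb S_k(\lambda)=\mathcal S_k+\lambda\mathcal V_k$ (invertible for each $\lambda\in\mathbb C$). System $(\mathrm S_\lambda)$: $z_k=\mathbb S_k(\lambda)z_{k+1}$, $k\in\mathcal I_{\mathbb Z}$, for sequences on $\mathcal I_{\mathbb Z}^+$. For a square matrix $M$: $\operatorname{Re}M=(M+M^* )/2$, $\operatorname{Im}M=(M-M^* )/(2i)$; $M\ge0$ means positive semidefinite. $\Gamma=\{\alpha\in\mathbb C^{n\times 2n}:\alpha\alpha^*=I_n,\ \alpha\mathcal J\alpha^*=0\}$. $\hat Z(\lambda),\tilde Z(\lambda)$ are the $2n\times n$ matrix solutions of $(\mathrm S_\lambda)$ with $\hat Z_0(\lambda)=\alpha^*$, $\tilde Z_0(\lambda)=-\mathcal J\alpha^*$. A number $\lambda\in\mathbb C$ is an eigenvalue if $(\mathrm S_\lambda)$ has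 a solution $z\not\equiv0$ with $\alpha z_0=0=\beta z_{N+1}$; equivalently $\det\beta\tilde Z_{N+1}(\lambda)=0$. Weak Atkinson condition (for $\alpha$): there is $\lambda\in\mathbb C$ such that $\sum_{k=0}^Nz_k^*\Psi_kz_k>0$ for every $z=\tilde Z(\lambda)\eta$, $0\neq\eta\in\mathbb C^n$. Under this condition there are finitely many eigenvalues, all real. $M_{N+1}(\lambda)=-[\beta\tilde Z_{N+1}(\lambda)]^{-1}\beta\hat Z_{N+1}(\lambda)$ for $\lambda$ not an eigenvalue. Let $\lambda_j$ run over the distinct eigenvalues, and for each $j$ let $\eta_j^{[1]},\dots,\eta_j^{[r_j]}$ be a basis of $\ker\beta\tilde Z_{N+1}(\lambda_j)\subseteq\mathbb C^n$ such that $\eta_j^{[\ell]*}\Omega_j\eta_j^{[m]}=\delta_{\ell m}$, where $\Omega_j=\sum_{k\in\mathcal I_{\mathbb Z}}\tilde Z_k^*(\lambda_j)\Psi_k\tilde Z_k(\lambda_j)>0$. The spectral function $\tau_{\alpha,\beta}:\mathbb R\to\mathbb C^{n\times n}$ is the Hermitian, nondecreasing, right-continuous step function $$\tau_{\alpha,\beta}(t)=\begin{cases}\sum_{0<\lambda_j\le t}\sum_{\ell=1}^{r_j}\eta_j^{[\ell]}\eta_j^{[\ell]*},&t>0,\\ -\sum_{t<\lambda_j\le0}\sum_{\ell=1}^{r_j}\eta_j^{[\ell]}\eta_j^{[\ell]*},&t<0,\\ 0,&t=0.\end{cases}$$ Integrals with respect to $\tau_{\alpha,\beta}$ are (entrywise)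 Riemann--Stieltjes integrals. *)

theory Defs
  imports "HOL-Analysis.Analysis"
begin

section \<open>Complex matrices\<close>

text \<open>
  An \<open>m \<times> n\<close> matrix has type \<^typ>\<open>complex^'n^'m\<close>; the index type \<^typ>\<open>'n + 'n\<close>
  plays the role of \<open>{1, \<dots>, 2n}\<close>, with \<^term>\<open>Inl\<close> for the first \<open>n\<close> indices.
\<close>

definition hadj :: "complex^'n^'m \<Rightarrow> complex^'m^'n"  (\<open>_\<^sup>\<dagger>\<close> [1000] 1000)
  where "A\<^sup>\<dagger> = transpose (map_matrix cnj A)"

definition mscale :: "complex \<Rightarrow> complex^'n^'m \<Rightarrow> complex^'n^'m"  (infixr \<open>\<cdot>\<close> 75)
  where "c \<cdot> A = map_matrix ((*) c) A"

text \<open>\<open>x\<^sup>* y\<close>, conjugate linear in the first argument.\<close>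

definition cdot :: "complex^'n \<Rightarrow> complex^'n \<Rightarrow> complex"
  where "cdot x y = (\<Sum>i\<in>UNIV. cnj (x $ i) * y $ i)"

text \<open>\<open>x x\<^sup>*\<close>\<close>

definition outer :: "complex^'n \<Rightarrow> complex^'n^'n"
  where "outer x = (\<chi> i j. x $ i * cnj (x $ j))"

definition psd :: "complex^'n^'n \<Rightarrow> bool"
  where "psd A \<longleftrightarrow> A\<^sup>\<dagger> = A \<and> (\<forall>x. 0 \<le> Re (cdot x (A *v x)))"

definition ReM :: "complex^'n^'n \<Rightarrow> complex^'n^'n"
  where "ReM A = (1 / 2) \<cdot> (A + A\<^sup>\<dagger>)"

definition ImM :: "complex^'n^'n \<Rightarrow> complex^'n^'n"
  where "ImM A = (1 / (2 * \<i>)) \<cdot> (A - A\<^sup>\<dagger>)"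

definition JJ :: "complex^('n::finite + 'n)^('n + 'n)"
  where "JJ = (\<chi> a b. case (a, b) of
      (Inl i, Inr j) \<Rightarrow> if i = j then -1 else 0
    | (Inr i, Inl j) \<Rightarrow> if i = j then 1 else 0
    | _ \<Rightarrow> 0)"

definition \<Gamma> :: "(complex^('n::finite + 'n)^'n) set"
  where "\<Gamma> = {\<alpha>. \<alpha> ** \<alpha>\<^sup>\<dagger> = mat 1 \<and> \<alpha> ** JJ ** \<alpha>\<^sup>\<dagger> = 0}"


section \<open>Discrete symplectic systems\<close>

text \<open>\<open>\<S>\<^sub>k + \<nu> \<V>\<^sub>k\<close> with \<open>\<V>\<^sub>k = - \<J> \<Psi>\<^sub>k \<S>\<^sub>k\<close>, where \<open>\<nu>\<close> is the spectral parameter.\<close>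

definition sys_mat ::
  "(nat \<Rightarrow> complex^('n::finite + 'n)^('n + 'n)) \<Rightarrow> (nat \<Rightarrow> complex^('n::finite + 'n)^('n + 'n)) \<Rightarrow>
   complex \<Rightarrow> nat \<Rightarrow> complex^('n::finite + 'n)^('n + 'n)"
  where "sys_mat S \<Psi> \<nu> k = S k + \<nu> \<cdot> (- (JJ ** \<Psi> k ** S k))"

text \<open>
  The system is considered for \<open>k \<in> {0, \<dots>, N}\<close> and its solutions live on
  \<open>{0, \<dots>, N + 1}\<close>; values of sequences at other indices are irrelevant.
\<close>

definition vec_solution ::
  "(nat \<Rightarrow> complex^('n::finite + 'n)^('n + 'n)) \<Rightarrow> (nat \<Rightarrow> complex^('n::finite + 'n)^('n + 'n)) \<Rightarrow> nat \<Rightarrow>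
   complex \<Rightarrow> (nat \<Rightarrow> complex^('n::finite + 'n)) \<Rightarrow> bool"
  where "vec_solution S \<Psi> N \<nu> z \<longleftrightarrow> (\<forall>k\<le>N. z k = sys_mat S \<Psi> \<nu> k *v z (k + 1))"

definition mat_solution ::
  "(nat \<Rightarrow> complex^('n::finite + 'n)^('n + 'n)) \<Rightarrow> (nat \<Rightarrow> complex^('n::finite + 'n)^('n + 'n)) \<Rightarrow> nat \<Rightarrow>
   complex \<Rightarrow> (nat \<Rightarrow> complex^'n^('n::finite + 'n)) \<Rightarrow> bool"
  where "mat_solution S \<Psi> N \<nu> Z \<longleftrightarrow> (\<forall>k\<le>N. Z k = sys_mat S \<Psi> \<nu> k ** Z (k + 1))"

definition is_eigenvalue ::
  "(nat \<Rightarrow> complex^('n::finite + 'n)^('n + 'n)) \<Rightarrow> (nat \<Rightarrow> complex^('n::finite + 'n)^('n + 'n)) \<Rightarrow> nat \<Rightarrow>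
   complex^('n::finite + 'n)^'n \<Rightarrow> complex^('n::finite + 'n)^'n \<Rightarrow> complex \<Rightarrow> bool"
  where "is_eigenvalue S \<Psi> N \<alpha> \<beta> \<nu> \<longleftrightarrow>
    (\<exists>z. vec_solution S \<Psi> N \<nu> z \<and> (\<exists>k\<le>N + 1. z k \<noteq> 0) \<and>
         \<alpha> *v z 0 = 0 \<and> \<beta> *v z (N + 1) = 0)"

text \<open>
  In the following, \<open>Zt \<nu>\<close> and \<open>Zh \<nu>\<close> stand for the matrix solutions with initial values
  \<open>- \<J> \<alpha>\<^sup>*\<close> and \<open>\<alpha>\<^sup>*\<close>, respectively. The quadratic form is real since the
  \<open>\<Psi>\<^sub>k\<close> are Hermitian.
\<close>

definition weak_Atkinson ::
  "(nat \<Rightarrow> complex^('n::finite + 'n)^('n + 'n)) \<Rightarrow> nat \<Rightarrow>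
   (complex \<Rightarrow> nat \<Rightarrow> complex^'n^('n::finite + 'n)) \<Rightarrow> bool"
  where "weak_Atkinson \<Psi> N Zt \<longleftrightarrow>
    (\<exists>\<nu>. \<forall>\<eta>. \<eta> \<noteq> 0 \<longrightarrow>
       0 < Re (\<Sum>k=0..N. cdot (Zt \<nu> k *v \<eta>) (\<Psi> k *v (Zt \<nu> k *v \<eta>))))"

definition weyl_M ::
  "nat \<Rightarrow> complex^('n::finite + 'n)^'n \<Rightarrow> (complex \<Rightarrow> nat \<Rightarrow> complex^'n^('n::finite + 'n)) \<Rightarrow>
   (complex \<Rightarrow> nat \<Rightarrow> complex^'n^('n::finite + 'n)) \<Rightarrow> complex \<Rightarrow> complex^'n^'n"
  where "weyl_M N \<beta> Zh Zt \<nu> =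
    - (matrix_inv (\<beta> ** Zt \<nu> (N + 1)) ** (\<beta> ** Zh \<nu> (N + 1)))"

definition gram ::
  "(nat \<Rightarrow> complex^('n::finite + 'n)^('n + 'n)) \<Rightarrow> nat \<Rightarrow>
   (complex \<Rightarrow> nat \<Rightarrow> complex^'n^('n::finite + 'n)) \<Rightarrow> complex \<Rightarrow> complex^'n^'n"
  where "gram \<Psi> N Zt \<nu> = (\<Sum>k=0..N. (Zt \<nu> k)\<^sup>\<dagger> ** \<Psi> k ** Zt \<nu> k)"

text \<open>
  \<open>B\<close> is a basis of the kernel of \<open>A\<close> (over the complex numbers), orthonormal with respect
  to the sesquilinear form of \<open>\<Omega>\<close>.
\<close>

definition orthonormal_kernel_basis ::
  "complex^'n^'n \<Rightarrow> complex^'n^'n \<Rightarrow> (complex^'n) set \<Rightarrow> bool"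
  where "orthonormal_kernel_basis \<Omega> A B \<longleftrightarrow>
    vec.independent B \<and> vec.span B = {x. A *v x = 0} \<and>
    (\<forall>u\<in>B. \<forall>v\<in>B. cdot u (\<Omega> *v v) = (if u = v then 1 else 0))"

text \<open>
  \<open>E\<close> is the set of eigenvalues and \<open>B s\<close> the basis chosen for the eigenvalue \<open>s\<close>.
\<close>

definition spectral_fun ::
  "complex set \<Rightarrow> (complex \<Rightarrow> (complex^'n) set) \<Rightarrow> real \<Rightarrow> complex^'n^'n"
  where "spectral_fun E B t =
    (if t > 0 then (\<Sum>s | 0 < s \<and> s \<le> t \<and> of_real s \<in> E. \<Sum>\<eta>\<in>B (of_real s). outer \<eta>)
     else if t < 0 then - (\<Sum>s | t < s \<and> s \<le> 0 \<and> of_real s \<in> E. \<Sum>\<eta>\<in>B (of_real s). outer \<eta>)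
     else 0)"


section \<open>Riemann--Stieltjes integrals\<close>

text \<open>
  On a compact interval: convergence of the Riemann--Stieltjes sums as the mesh tends to \<open>0\<close>.
  Fineness is measured with a gauge of constant radius, so this is a Riemann-type and not a
  Henstock--Kurzweil-type integral.
\<close>

definition has_RS_integral ::
  "(real \<Rightarrow> complex) \<Rightarrow> (real \<Rightarrow> complex) \<Rightarrow> complex \<Rightarrow> real \<Rightarrow> real \<Rightarrow> bool"
  where "has_RS_integral f g I a b \<longleftrightarrow>
    (\<forall>\<epsilon>>0. \<exists>\<delta>>0. \<forall>p. p tagged_division_of {a..b} \<and> (\<lambda>x. ball x \<delta>) fine p \<longrightarrow>
       norm ((\<Sum>(x, K)\<in>p. f x * (g (Sup K) - g (Inf K))) - I) < \<epsilon>)"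

text \<open>Improper integral over the real line, both end points tending to infinity independently.\<close>

definition has_RS_integral_line ::
  "(real \<Rightarrow> complex) \<Rightarrow> (real \<Rightarrow> complex) \<Rightarrow> complex \<Rightarrow> bool"
  where "has_RS_integral_line f g I \<longleftrightarrow>
    (\<exists>F. (\<forall>a b. a \<le> b \<longrightarrow> has_RS_integral f g (F a b) a b) \<and>
         ((\<lambda>(a, b). F a b) \<longlongrightarrow> I) (at_bot \<times>\<^sub>F at_top))"

definition has_RS_integral_mat ::
  "(real \<Rightarrow> complex) \<Rightarrow> (real \<Rightarrow> complex^'n^'m) \<Rightarrow> complex^'n^'m \<Rightarrow> bool"
  where "has_RS_integral_mat f \<tau> I \<longleftrightarrow>
    (\<forall>i j. has_RS_integral_line f (\<lambda>t. \<tau> t $ i $ j) (I $ i $ j))"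

end

theory Submission
  imports Defs "HOL-Computational_Algebra.Fundamental_Theorem_Algebra"
begin

text \<open>
  Let \<open>X = Zh + Zt M\<close> be the Weyl solution, so that \<open>\<beta> X\<^sub>N\<^sub>+\<^sub>1 = 0\<close>. Lagrange's
  identity gives \<open>M(\<nu>) - M(\<mu>)\<^sup>* = (\<nu> - \<mu>\<^sup>*) \<Sum> X\<^sub>k(\<mu>)\<^sup>* \<Psi>\<^sub>k X\<^sub>k(\<nu>)\<close>. For
  \<open>\<mu> = \<i>\<close>, Cauchy--Schwarz turns this into a bound of every entry of \<open>M(\<nu>)\<close> by a multiple
  of \<open>1 + |\<nu> + \<i>|\<^sup>2 / |Im \<nu>|\<close>. Since \<open>M\<close> is rational with poles among the (real) eigenvalues,
  the bound near an eigenvalue and along the imaginary axis shows that all poles are simple and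
  that the polynomial part is at most linear:
  \<open>M(\<nu>) = A + \<nu> M1 + \<Sum> C\<^sub>a / (a - \<nu>)\<close>. The residue \<open>C\<^sub>a\<close> is then identified with the
  jump of the spectral function at \<open>a\<close>.
\<close>

section \<open>Matrix algebra\<close>

text \<open>Two features of the system shape the argument. The recursion runs from k + 1 down to k,
  while initial values are prescribed at 0, so its matrices must be inverted. Because \<Psi> J
  \<Psi> = 0, the inverse is affine in the spectral parameter; this makes solutions polynomial and M
  rational. The same identity removes the quadratic term from Lagrange's identity. Moreover,
  positivity is assumed at one parameter only. It spreads to all parameters because a solution
  annihilated by every \<Psi> k does not feel the parameter.

  Freezing \<mu> = i makes the energy of X(i) a constant, while the energy of X(\<nu>) is a diagonal
  entry of Im M(\<nu>) / Im \<nu>. Weighted AM-GM therefore returns half of |M_jj(\<nu>)| on the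
  right, which is absorbed for i = j and then serves the other entries.

  The bound is void on the real axis, so poles are examined along vertical lines. Zeros of the
  determinant may be multiple; simplicity of the poles of M comes from growth alone. The measure
  consists of finitely many point masses, hence every integral is a finite sum.\<close>

lemma hadj_nth [simp]: "A\<^sup>\<dagger> $ i $ j = cnj (A $ j $ i)"
  by (simp add: hadj_def transpose_def map_matrix_def)

lemma mscale_nth [simp]: "(c \<cdot> A) $ i $ j = c * A $ i $ j"
  by (simp add: mscale_def map_matrix_def)

lemma matmul_nth: "(A ** B) $ i $ j = (\<Sum>k\<in>UNIV. A $ i $ k * B $ k $ j)"
  by (simp add: matrix_matrix_mult_def)

lemma mv_nth: "(A *v x) $ i = (\<Sum>k\<in>UNIV. A $ i $ k * x $ k)"
  by (simp add: matrix_vector_mult_def)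

lemma hadj_mult: "(A ** B)\<^sup>\<dagger> = B\<^sup>\<dagger> ** A\<^sup>\<dagger>"
  by (simp add: vec_eq_iff matmul_nth mult.commute)

lemma hadj_add: "(A + B)\<^sup>\<dagger> = A\<^sup>\<dagger> + B\<^sup>\<dagger>"
  by (simp add: vec_eq_iff)

lemma hadj_minus: "(- A)\<^sup>\<dagger> = - A\<^sup>\<dagger>"
  by (simp add: vec_eq_iff)

lemma hadj_diff: "(A - B)\<^sup>\<dagger> = A\<^sup>\<dagger> - B\<^sup>\<dagger>"
  by (simp add: vec_eq_iff)

lemma hadj_hadj [simp]: "A\<^sup>\<dagger>\<^sup>\<dagger> = A"
  by (simp add: vec_eq_iff)

lemma hadj_0 [simp]: "0\<^sup>\<dagger> = 0"
  by (simp add: vec_eq_iff)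

lemma hadj_mat_1 [simp]: "(mat 1)\<^sup>\<dagger> = mat 1"
  by (auto simp: vec_eq_iff mat_def)

lemma hadj_mscale: "(c \<cdot> A)\<^sup>\<dagger> = cnj c \<cdot> A\<^sup>\<dagger>"
  by (simp add: vec_eq_iff)

lemma hadj_sum: "(\<Sum>k\<in>K. F k)\<^sup>\<dagger> = (\<Sum>k\<in>K. (F k)\<^sup>\<dagger>)"
  by (induction K rule: infinite_finite_induct) (simp_all add: hadj_add)

lemma mscale_add: "c \<cdot> (A + B) = c \<cdot> A + c \<cdot> B"
  by (simp add: vec_eq_iff algebra_simps)

lemma mscale_diff_left: "(c - d) \<cdot> A = c \<cdot> A - d \<cdot> A"
  by (simp add: vec_eq_iff algebra_simps)

lemma mscale_diff: "c \<cdot> (A - B) = c \<cdot> A - c \<cdot> B"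
  by (simp add: vec_eq_iff algebra_simps)

lemma mscale_minus: "c \<cdot> (- A) = - (c \<cdot> A)"
  by (simp add: vec_eq_iff)

lemma mscale_mscale: "c \<cdot> d \<cdot> A = (c * d) \<cdot> A"
  by (simp add: vec_eq_iff)

lemma mscale_0 [simp]: "0 \<cdot> A = 0" "c \<cdot> 0 = 0"
  by (simp_all add: vec_eq_iff)

lemma mscale_sum: "c \<cdot> (\<Sum>k\<in>K. F k) = (\<Sum>k\<in>K. c \<cdot> F k)"
  by (induction K rule: infinite_finite_induct) (simp_all add: mscale_add)

lemma matmul_mscale_left: "(c \<cdot> A) ** B = c \<cdot> (A ** B)"
  by (simp add: vec_eq_iff matmul_nth sum_distrib_left mult.assoc)

lemma matmul_mscale_right: "A ** (c \<cdot> B) = c \<cdot> (A ** B)"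
  by (simp add: vec_eq_iff matmul_nth sum_distrib_left mult_ac)

lemma matmul_minus_left: "(- A) ** B = - (A ** B)" for A :: "complex^'m^'n"
  by (simp add: vec_eq_iff matmul_nth sum_negf)

lemma matmul_minus_right: "A ** (- B) = - (A ** B)" for A :: "complex^'m^'n"
  by (simp add: vec_eq_iff matmul_nth sum_negf)

lemma matmul_diff_left: "(A - B) ** C = A ** C - B ** C" for A :: "complex^'m^'n"
  by (simp add: vec_eq_iff matmul_nth sum_subtractf algebra_simps)

lemma matmul_diff_right: "A ** (B - C) = A ** B - A ** C" for A :: "complex^'m^'n"
  by (simp add: vec_eq_iff matmul_nth sum_subtractf algebra_simps)

lemma matmul_add_left: "(A + B) ** C = A ** C + B ** C" for A :: "complex^'m^'n"
  by (simp add: vec_eq_iff matmul_nth sum.distrib algebra_simps)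

lemma matmul_sum_right: "A ** (\<Sum>k\<in>K. F k) = (\<Sum>k\<in>K. A ** F k)" for A :: "complex^'m^'n"
  by (induction K rule: infinite_finite_induct) (simp_all add: matrix_add_ldistrib)

lemma mv_minus_left: "(- A) *v x = - (A *v x)" for A :: "complex^'m^'n"
  by (simp add: vec_eq_iff mv_nth sum_negf)

lemma mv_sum_left: "(\<Sum>k\<in>K. F k) *v x = (\<Sum>k\<in>K. F k *v x)" for x :: "complex^'m"
  by (induction K rule: infinite_finite_induct) (simp_all add: matrix_vector_mult_add_rdistrib)

lemma mv_scale: "A *v (c *s x) = c *s (A *v x)" for x :: "complex^'m"
  by (simp add: vec_eq_iff mv_nth sum_distrib_left mult_ac)

lemma mv_mscale: "(c \<cdot> A) *v x = c *s (A *v x)"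
  by (simp add: vec_eq_iff mv_nth sum_distrib_left mult.assoc)

text \<open>\<open>matrix_mul_assoc\<close> drives all products into left-nested form. A
  cancellation law such as \<open>JJ_JJ\<close> then no longer matches inside a longer product,
  which is why variants with an arbitrary left factor appear later.\<close>

lemmas matrix_algebra = hadj_mult hadj_add hadj_diff hadj_minus hadj_mscale mscale_add mscale_diff mscale_minus
  mscale_mscale matmul_mscale_left matmul_mscale_right matmul_minus_left matmul_minus_right
  matmul_diff_left matmul_diff_right matrix_add_ldistrib matmul_add_left matrix_mul_assoc

section \<open>The sesquilinear pairing and positive semidefinite matrices\<close>

lemma cdot_adjoint: "cdot x (A *v y) = cdot (A\<^sup>\<dagger> *v x) y"
proof -
  have "cdot x (A *v y) = (\<Sum>i\<in>UNIV. \<Sum>j\<in>UNIV. cnj (x $ i) * (A $ i $ j * y $ j))"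
    by (simp add: cdot_def mv_nth sum_distrib_left)
  also have "\<dots> = (\<Sum>j\<in>UNIV. \<Sum>i\<in>UNIV. cnj (x $ i) * (A $ i $ j * y $ j))"
    by (rule sum.swap)
  also have "\<dots> = cdot (A\<^sup>\<dagger> *v x) y"
    by (simp add: cdot_def mv_nth sum_distrib_right) (simp add: mult_ac)
  finally show ?thesis .
qed

lemma cdot_0 [simp]: "cdot 0 x = 0" "cdot x 0 = 0"
  by (simp_all add: cdot_def)

lemma cdot_add: "cdot (x + y) z = cdot x z + cdot y z" "cdot z (x + y) = cdot z x + cdot z y"
  by (simp_all add: cdot_def algebra_simps sum.distrib)

lemma cdot_diff: "cdot (x - y) z = cdot x z - cdot y z" "cdot z (x - y) = cdot z x - cdot z y"
  by (simp_all add: cdot_def algebra_simps sum_subtractf)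

lemma cdot_minus: "cdot (- x) z = - cdot x z" "cdot z (- x) = - cdot z x"
  by (simp_all add: cdot_def sum_negf)

lemma cdot_scale: "cdot (c *s x) z = cnj c * cdot x z" "cdot z (c *s x) = c * cdot z x"
  by (simp_all add: cdot_def sum_distrib_left mult_ac)

lemma cdot_sum_right: "cdot z (\<Sum>k\<in>K. f k) = (\<Sum>k\<in>K. cdot z (f k))"
  by (induction K rule: infinite_finite_induct) (simp_all add: cdot_add)

lemma cnj_cdot: "cnj (cdot x y) = cdot y x"
  by (simp add: cdot_def mult.commute)

lemma cdot_self: "cdot x x = of_real (\<Sum>i\<in>UNIV. (cmod (x $ i))\<^sup>2)"
  by (simp add: cdot_def complex_norm_square[symmetric, unfolded of_real_power] mult.commute[of "cnj _"])

lemma cdot_self_eq_0_iff: "cdot x x = 0 \<longleftrightarrow> x = 0"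
  by (auto simp: cdot_self vec_eq_iff sum_nonneg_eq_0_iff simp flip: of_real_sum of_real_power)

lemma cdot_axis: "cdot (axis i 1) (A *v axis j 1) = A $ i $ j"
  by (simp add: cdot_def mv_nth axis_def if_distrib if_distribR cong: if_cong)

lemma psd_adjoint: "psd A \<Longrightarrow> A\<^sup>\<dagger> = A"
  by (simp add: psd_def)

lemma psd_nonneg: "psd A \<Longrightarrow> 0 \<le> Re (cdot x (A *v x))"
  by (simp add: psd_def)

lemma psd_diagonal:
  assumes "psd A"
  shows "0 \<le> Re (A $ i $ i)"
  using psd_nonneg[OF assms, of "axis i 1"] by (simp add: cdot_axis)

lemma psd_conj:
  assumes "psd A"
  shows "psd (B\<^sup>\<dagger> ** A ** B)"
proof -
  have "cdot x ((B\<^sup>\<dagger> ** A ** B) *v x) = cdot (B *v x) (A *v (B *v x))" for x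
    by (simp add: cdot_adjoint matrix_vector_mul_assoc hadj_mult psd_adjoint[OF assms] matrix_mul_assoc)
  with assms show ?thesis
    by (simp add: psd_def hadj_mult matrix_mul_assoc)
qed

lemma psd_sum:
  assumes "\<And>k. k \<in> K \<Longrightarrow> psd (F k)"
  shows "psd (\<Sum>k\<in>K. F k)"
  using assms by (auto simp: psd_def hadj_sum mv_sum_left cdot_sum_right intro!: sum_nonneg)

text \<open>
  Cauchy--Schwarz in its AM--GM form: the free parameter \<open>s\<close> is chosen later so that
  the second term can be absorbed.
\<close>

lemma psd_form_bound:
  assumes A: "psd A" and s: "0 < s"
  shows "2 * cmod (cdot x (A *v y)) \<le> Re (cdot x (A *v x)) / s + s * Re (cdot y (A *v y))"
proof -
  define c where "c = cdot x (A *v y)"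
  \<comment> \<open>The opposite conjugate phase of \<open>c\<close>, scaled by \<open>s\<close>: it
    turns the cross terms of the form at \<open>x + t *s y\<close> into
    \<open>- 2 * s * cmod c\<close>. For \<open>c = 0\<close> there is no phase, and
    \<open>t = 0\<close> serves.\<close>
  define t where "t = - of_real s * (if c = 0 then 0 else cnj c / of_real (cmod c))"
  have t_c: "t * c = - of_real (s * cmod c)"
    using complex_norm_square[of c]
    by (auto simp: t_def divide_simps power2_eq_square mult_ac)
  have cnj_t: "cnj t * t = of_real (s\<^sup>2) \<or> c = 0 \<and> t = 0"
    using complex_norm_square[of c] by (auto simp: t_def power2_eq_square divide_simps mult_ac)
  have cyx: "cdot y (A *v x) = cnj c"
    by (simp add: c_def cnj_cdot cdot_adjoint psd_adjoint[OF A])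
  have "cdot (x + t *s y) (A *v (x + t *s y))
      = cdot x (A *v x) + t * c + cnj (t * c) + cnj t * t * cdot y (A *v y)"
    by (simp add: matrix_vector_right_distrib mv_scale cdot_add cdot_scale
        cyx c_def[symmetric] algebra_simps)
  then have "0 \<le> Re (cdot x (A *v x)) - 2 * (s * cmod c) + Re (cnj t * t * cdot y (A *v y))"
    using psd_nonneg[OF A, of "x + t *s y"] by (simp add: t_c)
  moreover have "Re (cnj t * t * cdot y (A *v y)) \<le> s\<^sup>2 * Re (cdot y (A *v y))"
    using cnj_t
  proof (elim disjE)
    assume "cnj t * t = of_real (s\<^sup>2)"
    moreover have "Re (of_real (s\<^sup>2) * w) = s\<^sup>2 * Re w" for w
      by (simp del: of_real_power)
    ultimately show ?thesis by (simp only: order_refl)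
  next
    assume "c = 0 \<and> t = 0"
    then show ?thesis using psd_nonneg[OF A, of y] by simp
  qed
  ultimately have "2 * (s * cmod c) \<le> Re (cdot x (A *v x)) + s\<^sup>2 * Re (cdot y (A *v y))"
    by linarith
  with s show ?thesis
    by (simp add: c_def[symmetric] field_simps power2_eq_square)
qed

text \<open>In the Cauchy--Schwarz bound for \<open>y = A *v x\<close> against \<open>x\<close>, the
  term multiplied by the free parameter vanishes, so the parameter may grow without limit.\<close>

lemma psd_kernel:
  assumes A: "psd A" and x: "Re (cdot x (A *v x)) = 0"
  shows "A *v x = 0"
proof -
  define y where "y = A *v x"
  define c where "c = Re (cdot y (A *v y))"
  have "cmod (cdot y y) \<le> e" if e: "e > 0" for e
  proof -
    have c: "c \<ge> 0"
      using psd_nonneg[OF A] by (simp add: c_def)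
    \<comment> \<open>The parameter is \<open>(c + 1) / (2 * e)\<close>; with \<open>c + 1\<close>
      instead of \<open>c\<close> it stays positive when \<open>c = 0\<close>, and the first term is
      still at most \<open>2 * e\<close>.\<close>
    have "2 * cmod (cdot y (A *v x)) \<le> c / ((c + 1) / (2 * e)) + (c + 1) / (2 * e) * 0"
      unfolding c_def x[symmetric] using c e by (intro psd_form_bound A) (simp add: c_def)
    also have "\<dots> \<le> 2 * e"
      using c e by (simp add: field_simps)
    finally show ?thesis
      by (simp add: y_def)
  qed
  then have "cdot y y = 0"
    by (metis dense_ge norm_le_zero_iff)
  then show ?thesis
    by (simp add: cdot_self_eq_0_iff y_def)
qed

section \<open>The matrix J and the boundary matrices\<close>

lemma sum_UNIV_sum: "(\<Sum>a\<in>(UNIV :: ('a::finite + 'b::finite) set). f a) = (\<Sum>i\<in>UNIV. f (Inl i)) + (\<Sum>j\<in>UNIV. f (Inr j))"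
  by (simp add: sum.Plus flip: UNIV_Plus_UNIV)

lemma JJ_nth [simp]:
  "JJ $ Inl i $ Inl j = 0" "JJ $ Inr i $ Inr j = 0"
  "JJ $ Inl i $ Inr j = (if i = j then -1 else 0)" "JJ $ Inr i $ Inl j = (if i = j then 1 else 0)"
  by (simp_all add: JJ_def)

lemma JJ_hadj: "JJ\<^sup>\<dagger> = - JJ"
proof -
  have "JJ\<^sup>\<dagger> $ a $ b = (- JJ) $ a $ b" for a b :: "'a + 'a"
    by (cases a; cases b) auto
  then show ?thesis
    by (simp add: vec_eq_iff)
qed

lemma JJ_JJ: "JJ ** JJ = - mat 1"
proof -
  have "(JJ ** JJ) $ a $ b = (- mat 1) $ a $ b" for a b :: "'a + 'a"
    by (cases a; cases b)
       (simp_all add: matmul_nth sum_UNIV_sum mat_def mult_delta_left mult_delta_right)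
  then show ?thesis
    by (simp add: vec_eq_iff)
qed

lemma \<Gamma>_adjoint_mult:
  fixes \<alpha> :: "complex^('n::finite + 'n)^'n"
  assumes "\<alpha> \<in> \<Gamma>"
  shows "\<alpha> ** \<alpha>\<^sup>\<dagger> = mat 1" "\<alpha> ** JJ ** \<alpha>\<^sup>\<dagger> = 0"
  using assms by (simp_all add: \<Gamma>_def)

text \<open>The matrix with block rows \<open>\<alpha>\<close> and \<open>\<alpha> \<J>\<close> is unitary.\<close>

lemma \<Gamma>_resolution:
  fixes \<alpha> :: "complex^('n::finite + 'n)^'n"
  assumes "\<alpha> \<in> \<Gamma>"
  shows "\<alpha>\<^sup>\<dagger> ** \<alpha> - JJ ** \<alpha>\<^sup>\<dagger> ** \<alpha> ** JJ = mat 1"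
proof -
  define \<gamma> where "\<gamma> = \<alpha> ** JJ"
  define U :: "complex^('n + 'n)^('n + 'n)"
    where "U = (\<chi> a. case a of Inl i \<Rightarrow> \<alpha> $ i | Inr i \<Rightarrow> \<gamma> $ i)"
  have *: "\<alpha> ** \<alpha>\<^sup>\<dagger> = mat 1" "\<gamma> ** \<alpha>\<^sup>\<dagger> = 0" "\<alpha> ** \<gamma>\<^sup>\<dagger> = 0" "\<gamma> ** \<gamma>\<^sup>\<dagger> = mat 1"
    using \<Gamma>_adjoint_mult[OF assms]
    by (simp_all add: \<gamma>_def matrix_algebra JJ_hadj JJ_JJ flip: matrix_mul_assoc[of \<alpha> JJ JJ])
  have "(U ** U\<^sup>\<dagger>) $ a $ b = mat 1 $ a $ b" for a b
    using *[unfolded vec_eq_iff matmul_nth]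
    by (cases a; cases b) (simp_all add: U_def matmul_nth mat_def)
  then have "U ** U\<^sup>\<dagger> = mat 1"
    by (simp add: vec_eq_iff)
  then have "U\<^sup>\<dagger> ** U = mat 1"
    by (simp add: matrix_left_right_inverse)
  moreover have "U\<^sup>\<dagger> ** U = \<alpha>\<^sup>\<dagger> ** \<alpha> + \<gamma>\<^sup>\<dagger> ** \<gamma>"
    by (simp add: vec_eq_iff matmul_nth sum_UNIV_sum U_def)
  ultimately show ?thesis
    by (simp add: \<gamma>_def matrix_algebra JJ_hadj)
qed

section \<open>Rational functions with a Herglotz bound\<close>

lemma prod_linear_dvd:
  fixes p :: "complex poly"
  assumes "finite R" "\<And>a. a \<in> R \<Longrightarrow> poly p a = 0"
  shows "(\<Prod>a\<in>R. [:- a, 1:]) dvd p"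
  using assms
proof (induction R arbitrary: p rule: finite_induct)
  case empty
  then show ?case by simp
next
  case (insert a R)
  from insert.prems[of a] obtain q where q: "p = [:- a, 1:] * q"
    unfolding poly_eq_0_iff_dvd by (metis dvdE insertI1)
  have "poly q b = 0" if "b \<in> R" for b
    using insert.prems[of b] insert.hyps that by (auto simp: q)
  then have "(\<Prod>a\<in>R. [:- a, 1:]) dvd q"
    by (rule insert.IH)
  then show ?case
    using insert.hyps by (simp add: q mult_dvd_mono del: mult_pCons_left)
qed

text \<open>Multiplicities are handled by cancelling one common linear factor at a time: a bound of
  q by d at a root forces q to vanish there, and the quotients inherit the bounds. Approaching from
  above suffices and matches an estimate that is available only off the real axis.\<close>

lemma poly_dvd_if_bounded:
  fixes d q :: "complex poly"
  assumes "d \<noteq> 0"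
    and "\<And>a. poly d a = 0 \<Longrightarrow>
      \<exists>C. \<forall>\<^sub>F \<epsilon> in at_right (0::real). cmod (poly q (a + \<i> * of_real \<epsilon>)) \<le> C * cmod (poly d (a + \<i> * of_real \<epsilon>))"
  shows "d dvd q"
  using assms
proof (induction "degree d" arbitrary: d q)
  case 0
  then show ?case
    by (metis dvd_trans is_unit_iff_degree one_dvd unit_imp_dvd)
next
  case (Suc n)
  have lim: "((\<lambda>\<epsilon>. poly p (b + \<i> * of_real \<epsilon>)) \<longlongrightarrow> poly p b) (at_right (0::real))" for p b
    by (rule tendsto_eq_intros refl | simp)+
  obtain a where a: "poly d a = 0"
    using fundamental_theorem_of_algebra_alt[of d] Suc.hyps(2) by force
  obtain C where C: "\<forall>\<^sub>F \<epsilon> in at_right (0::real).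
      cmod (poly q (a + \<i> * of_real \<epsilon>)) \<le> C * cmod (poly d (a + \<i> * of_real \<epsilon>))"
    using Suc.prems(2)[OF a] by blast
  have "cmod (poly q a) \<le> C * cmod (poly d a)"
    using trivial_limit_at_right_real C
    by (intro tendsto_le[OF _ _ _ C] tendsto_intros lim) auto
  with a have q_a: "poly q a = 0"
    by simp
  from a q_a obtain d1 q1 where d1: "d = [:- a, 1:] * d1" and q1: "q = [:- a, 1:] * q1"
    unfolding poly_eq_0_iff_dvd by (metis dvdE)
  have "d1 \<noteq> 0"
    using Suc.prems(1) d1 by auto
  moreover have "n = degree d1"
    using Suc.hyps(2) \<open>d1 \<noteq> 0\<close> by (simp add: d1 degree_mult_eq del: mult_pCons_left)
  moreover have "\<exists>C. \<forall>\<^sub>F \<epsilon> in at_right (0::real).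
      cmod (poly q1 (b + \<i> * of_real \<epsilon>)) \<le> C * cmod (poly d1 (b + \<i> * of_real \<epsilon>))" if "poly d1 b = 0" for b
  proof -
    have "poly d b = 0"
      using that by (simp add: d1)
    then obtain C where C: "\<forall>\<^sub>F \<epsilon> in at_right (0::real).
        cmod (poly q (b + \<i> * of_real \<epsilon>)) \<le> C * cmod (poly d (b + \<i> * of_real \<epsilon>))"
      using Suc.prems(2) by blast
    \<comment> \<open>The root \<open>b\<close> may coincide with \<open>a\<close>; even then the
      vertical path avoids \<open>a\<close>, so the common factor can be cancelled.\<close>
    have "\<forall>\<^sub>F \<epsilon> in at_right (0::real). b + \<i> * of_real \<epsilon> \<noteq> a"
    proof (cases "b = a")
      case True
      then show ?thesis
        by (auto simp: eventually_at_right_less intro: eventually_mono[OF eventually_at_right_less])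
    next
      case False
      have "((\<lambda>\<epsilon>. b + \<i> * of_real \<epsilon>) \<longlongrightarrow> b) (at_right (0::real))"
        by (rule tendsto_eq_intros refl | simp)+
      with False show ?thesis
        by (intro tendsto_imp_eventually_ne) auto
    qed
    with C have "\<forall>\<^sub>F \<epsilon> in at_right (0::real).
        cmod (poly q1 (b + \<i> * of_real \<epsilon>)) \<le> C * cmod (poly d1 (b + \<i> * of_real \<epsilon>))"
    proof eventually_elim
      case (elim \<epsilon>)
      have *: "poly q z = (z - a) * poly q1 z" "poly d z = (z - a) * poly d1 z" for z
        by (simp_all add: d1 q1 algebra_simps)
      define z where "z = b + \<i> * of_real \<epsilon>"
      have "cmod (z - a) * cmod (poly q1 z) \<le> cmod (z - a) * (C * cmod (poly d1 z))"
        using elim(1) by (simp add: z_def[symmetric] * norm_mult mult_ac)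
      moreover have "cmod (z - a) > 0"
        using elim(2) by (simp add: z_def)
      ultimately show ?case
        by (simp add: z_def[symmetric])
    qed
    then show ?thesis ..
  qed
  ultimately have "d1 dvd q1"
    using Suc.hyps(1) by blast
  then show ?case
    by (simp add: d1 q1 mult_dvd_mono del: mult_pCons_left)
qed

text \<open>Two coefficients are split off. If a nonzero rest \<open>t\<close> remained,
  \<open>c1 + z * t\<close> would be unbounded at infinity, against linear growth on the upper
  imaginary axis.\<close>

lemma poly_linear_if_bounded:
  fixes s :: "complex poly"
  assumes "\<And>\<mu>::real. \<mu> \<ge> 1 \<Longrightarrow> cmod (poly s (\<i> * of_real \<mu>)) \<le> K * \<mu>"
  shows "\<exists>c0 c1. s = [:c0, c1:]"
proof -
  obtain c0 u where u: "s = pCons c0 u" by (cases s)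
  obtain c1 t where t: "u = pCons c1 t" by (cases u)
  have "t = 0"
  proof (rule ccontr)
    assume "t \<noteq> 0"
    \<comment> \<open>Dividing the growth bound by \<open>\<mu> \<ge> 1\<close> gives at most
      \<open>K + cmod c0\<close> for \<open>cmod (poly u z)\<close>; the extra 1 produces the
      contradiction.\<close>
    from poly_infinity[OF this, of "K + cmod c0 + 1" c1] obtain r where
      r: "\<And>z. r \<le> cmod z \<Longrightarrow> K + cmod c0 + 1 \<le> cmod (poly u z)"
      by (auto simp: t)
    define \<mu> where "\<mu> = max 1 r"
    have \<mu>: "\<mu> \<ge> 1" "\<mu> \<ge> r" by (auto simp: \<mu>_def)
    define z where "z = \<i> * complex_of_real \<mu>"
    have z: "cmod z = \<mu>"
      using \<mu> by (simp add: z_def norm_mult)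
    have "\<mu> * (K + cmod c0 + 1) \<le> cmod z * cmod (poly u z)"
      using r[of z] \<mu> by (simp add: z)
    also have "\<dots> = cmod (poly s z - c0)"
      by (simp add: u norm_mult)
    also have "\<dots> \<le> cmod (poly s z) + cmod c0"
      by (rule norm_triangle_ineq4)
    also have "\<dots> \<le> K * \<mu> + cmod c0 * \<mu>"
      using assms[of \<mu>] \<mu> by (intro add_mono) (auto simp: z_def mult_le_cancel_left1)
    finally show False
      using \<mu> by (simp add: algebra_simps)
  qed
  then show ?thesis
    by (simp add: u t)
qed

text \<open>The bound is of order 1 / |Im z| at a real root of d, so one linear factor per distinct
  root clears the denominator, whatever the multiplicities in d. On the imaginary axis the bound is
  linear, which limits the polynomial part.\<close>

lemma partial_fractions_if_bounded:
  fixes d q :: "complex poly"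
  assumes d: "d \<noteq> 0"
    and roots: "{a. poly d a = 0} \<subseteq> \<real>"
    and fq: "\<And>z. poly d z \<noteq> 0 \<Longrightarrow> f z * poly d z = poly q z"
    and bound: "\<And>z. z \<notin> \<real> \<Longrightarrow> cmod (f z) \<le> K * (1 + (cmod (z + \<i>))\<^sup>2 / \<bar>Im z\<bar>)"
  shows "\<exists>c0 c1 c. \<forall>z. poly d z \<noteq> 0 \<longrightarrow> f z = c0 + z * c1 + (\<Sum>a | poly d a = 0. c a / (a - z))"
proof -
  define R where "R = {a. poly d a = 0}"
  have finR: "finite R"
    using d by (simp add: R_def poly_roots_finite)
  \<comment> \<open>The squarefree part of \<open>d\<close>: each root is taken once.\<close>
  define r where "r = (\<Prod>a\<in>R. [:- a, 1:])"
  have poly_r: "poly r z = (\<Prod>a\<in>R. z - a)" for z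
    by (simp add: r_def poly_prod)
  have r0: "r \<noteq> 0"
    using finR by (simp add: r_def)
  have nonreal: "poly d z \<noteq> 0" if "Im z \<noteq> 0" for z
    using roots that by (auto simp: complex_is_Real_iff)
  have K: "0 \<le> K"
  proof -
    have "0 \<le> K * (1 + (cmod (\<i> + \<i>))\<^sup>2 / \<bar>Im \<i>\<bar>)"
      using bound[of \<i>] by (rule order_trans[OF norm_ge_zero]) (simp add: complex_is_Real_iff)
    then show ?thesis
      by (simp add: zero_le_mult_iff power2_eq_square)
  qed
  have "d dvd q * r"
  proof (rule poly_dvd_if_bounded[OF d])
    fix a assume a: "poly d a = 0"
    define R' where "R' = R - {a}"
    have "a \<in> R" using a by (simp add: R_def)
    have a_real: "Im a = 0"
      using nonreal[of a] a by auto
    \<comment> \<open>For \<open>\<epsilon> < 1\<close> the point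
      \<open>a + \<i> * of_real \<epsilon>\<close> has modulus at most \<open>cmod a + 1\<close>.
      The factor \<open>z - a\<close> of \<open>r\<close> supplies the \<epsilon> that compensates
      the growth of \<open>f\<close>.\<close>
    define P where "P = K * (1 + (cmod a + 2)\<^sup>2) * (\<Prod>b\<in>R'. cmod a + 1 + cmod b)"
    have "cmod (poly (q * r) z) \<le> P * cmod (poly d z)"
      if \<epsilon>: "0 < \<epsilon>" "\<epsilon> < 1" and z: "z = a + \<i> * of_real \<epsilon>" for \<epsilon> z
    proof -
      have Imz: "Im z = \<epsilon>"
        using a_real by (simp add: z)
      have cz: "cmod z \<le> cmod a + 1"
        using norm_triangle_ineq[of a "\<i> * of_real \<epsilon>"] \<epsilon> by (simp add: z norm_mult)
      have "cmod (z + \<i>) \<le> cmod a + 2"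
        using norm_triangle_ineq[of z \<i>] cz by simp
      then have "(cmod (z + \<i>))\<^sup>2 \<le> (cmod a + 2)\<^sup>2"
        by (rule power_mono) simp
      then have 1: "\<epsilon> + (cmod (z + \<i>))\<^sup>2 \<le> 1 + (cmod a + 2)\<^sup>2"
        using \<epsilon> by linarith
      have "cmod (f z) * \<epsilon> \<le> K * (1 + (cmod (z + \<i>))\<^sup>2 / \<epsilon>) * \<epsilon>"
        using bound[of z] \<epsilon> Imz by (intro mult_right_mono) (auto simp: complex_is_Real_iff)
      also have "\<dots> = K * (\<epsilon> + (cmod (z + \<i>))\<^sup>2)"
        using \<epsilon> by (simp add: field_simps)
      also have "\<dots> \<le> K * (1 + (cmod a + 2)\<^sup>2)"
        by (intro mult_left_mono 1 K)
      finally have 2: "cmod (f z) * \<epsilon> \<le> K * (1 + (cmod a + 2)\<^sup>2)" .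
      have "cmod (poly r z) = \<epsilon> * (\<Prod>b\<in>R'. cmod (z - b))"
        using \<open>a \<in> R\<close> finR \<epsilon>
        by (simp add: poly_r R'_def prod.remove[of R a] norm_mult prod_norm z)
      also have "\<dots> \<le> \<epsilon> * (\<Prod>b\<in>R'. cmod a + 1 + cmod b)"
        using \<epsilon> cz by (intro mult_left_mono prod_mono)
          (auto intro: order_trans[OF norm_triangle_ineq4])
      finally have 3: "cmod (poly r z) \<le> \<epsilon> * (\<Prod>b\<in>R'. cmod a + 1 + cmod b)" .
      have "cmod (f z) * cmod (poly r z) \<le> cmod (f z) * (\<epsilon> * (\<Prod>b\<in>R'. cmod a + 1 + cmod b))"
        by (intro mult_left_mono 3) auto
      also have "\<dots> = (cmod (f z) * \<epsilon>) * (\<Prod>b\<in>R'. cmod a + 1 + cmod b)"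
        by simp
      also have "\<dots> \<le> P"
        unfolding P_def by (intro mult_right_mono 2 prod_nonneg) auto
      finally have "cmod (f z) * cmod (poly r z) * cmod (poly d z) \<le> P * cmod (poly d z)"
        by (intro mult_right_mono) auto
      then show ?thesis
        using nonreal[of z] Imz \<epsilon> by (simp add: fq[symmetric] norm_mult mult_ac)
    qed
    then have "\<forall>\<^sub>F \<epsilon> in at_right (0::real).
        cmod (poly (q * r) (a + \<i> * of_real \<epsilon>)) \<le> P * cmod (poly d (a + \<i> * of_real \<epsilon>))"
      by (auto simp: eventually_at_right_field intro!: exI[of _ 1])
    then show "\<exists>C. \<forall>\<^sub>F \<epsilon> in at_right (0::real).
        cmod (poly (q * r) (a + \<i> * of_real \<epsilon>)) \<le> C * cmod (poly d (a + \<i> * of_real \<epsilon>))" ..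
  qed
  then obtain h where h: "q * r = d * h" ..
  have fr: "f z * poly r z = poly h z" if "poly d z \<noteq> 0" for z
  proof -
    have "poly d z * (f z * poly r z) = poly d z * poly h z"
      using arg_cong[OF h, of "\<lambda>p. poly p z"] that by (simp add: fq[symmetric] mult_ac)
    with that show ?thesis by simp
  qed
  define L where "L a = (\<Prod>b\<in>R - {a}. [:- b, 1:])" for a
  have poly_L: "poly (L a) z = (\<Prod>b\<in>R - {a}. z - b)" for a z
    by (simp add: L_def poly_prod)
  have L_a: "poly (L a) a \<noteq> 0" for a
    using finR by (simp add: poly_L)
  have L_b: "poly (L a) b = 0" if "b \<in> R" "b \<noteq> a" for a b
    using finR that by (auto simp: poly_L)
  \<comment> \<open>Lagrange interpolation at the roots. The minus sign comes from writing the
    fractions with \<open>a - z\<close> instead of \<open>z - a\<close>, as in the Cauchy kernel of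
    the theorem.\<close>
  define c where "c a = - poly h a / poly (L a) a" for a
  have "r dvd h + (\<Sum>a\<in>R. smult (c a) (L a))"
    unfolding r_def
  proof (rule prod_linear_dvd[OF finR])
    fix b assume b: "b \<in> R"
    have "poly (L a) b = 0" if "a \<in> R - {b}" for a
      using that by (intro L_b[OF b]) auto
    then have "(\<Sum>a\<in>R. c a * poly (L a) b) = c b * poly (L b) b"
      using finR b by (simp add: sum.remove[of _ b])
    then show "poly (h + (\<Sum>a\<in>R. smult (c a) (L a))) b = 0"
      using L_a[of b] by (simp add: poly_sum c_def)
  qed
  then obtain s where s: "h + (\<Sum>a\<in>R. smult (c a) (L a)) = r * s" ..
  have f_eq: "f z = poly s z + (\<Sum>a\<in>R. c a / (a - z))" if z: "poly d z \<noteq> 0" for z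
  proof -
    have "z \<notin> R" using z by (simp add: R_def)
    then have rz: "poly r z \<noteq> 0"
      using finR by (auto simp: poly_r)
    have "poly (L a) z = - poly r z / (a - z)" if "a \<in> R" for a
    proof -
      have "poly r z = (z - a) * poly (L a) z"
        using finR that by (simp add: poly_r poly_L prod.remove)
      moreover have "z \<noteq> a" using that \<open>z \<notin> R\<close> by auto
      ultimately show ?thesis by (simp add: field_simps)
    qed
    then have "(\<Sum>a\<in>R. c a * poly (L a) z) = - poly r z * (\<Sum>a\<in>R. c a / (a - z))"
      by (simp add: sum_distrib_left mult.commute)
    with arg_cong[OF s, of "\<lambda>p. poly p z"]
    have "poly h z = poly r z * (poly s z + (\<Sum>a\<in>R. c a / (a - z)))"
      by (simp add: poly_sum algebra_simps)
    with fr[OF z] rz show ?thesis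
      by (simp add: mult.commute)
  qed
  have "cmod (poly s (\<i> * of_real \<mu>)) \<le> (K * 5 + (\<Sum>a\<in>R. cmod (c a))) * \<mu>" if \<mu>: "\<mu> \<ge> 1" for \<mu>
  proof -
    define z where "z = \<i> * complex_of_real \<mu>"
    have Imz: "Im z = \<mu>" by (simp add: z_def)
    have cz: "cmod (z + \<i>) = \<mu> + 1"
    proof -
      have "z + \<i> = \<i> * of_real (\<mu> + 1)" by (simp add: z_def algebra_simps)
      then show ?thesis using \<mu> by (simp only: norm_mult norm_of_real) simp
    qed
    have "1 + (\<mu> + 1)\<^sup>2 / \<mu> \<le> 5 * \<mu>"
    proof -
      \<comment> \<open>The difference of the two sides is
        \<open>(\<mu> - 1) * (4 * \<mu> + 1)\<close>.\<close>
      have "\<mu> + (\<mu> + 1)\<^sup>2 \<le> 5 * \<mu>\<^sup>2"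
        using mult_nonneg_nonneg[of "\<mu> - 1" "4 * \<mu> + 1"] \<mu>
        by (simp add: power2_eq_square algebra_simps)
      with \<mu> show ?thesis by (simp add: field_simps power2_eq_square)
    qed
    with K have "K * (1 + (\<mu> + 1)\<^sup>2 / \<mu>) \<le> K * (5 * \<mu>)"
      by (intro mult_left_mono)
    then have 1: "cmod (f z) \<le> K * 5 * \<mu>"
      using bound[of z] Imz \<mu> by (auto simp: cz complex_is_Real_iff)
    have "cmod (\<Sum>a\<in>R. c a / (a - z)) \<le> (\<Sum>a\<in>R. cmod (c a))"
    proof (rule sum_norm_le)
      fix a assume "a \<in> R"
      then have "Im a = 0" using nonreal by (auto simp: R_def)
      then have "1 \<le> cmod (a - z)"
        using abs_Im_le_cmod[of "a - z"] Imz \<mu> by simp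
      then show "cmod (c a / (a - z)) \<le> cmod (c a)"
        by (simp add: norm_divide divide_le_eq mult_le_cancel_left1)
    qed
    also have "\<dots> \<le> (\<Sum>a\<in>R. cmod (c a)) * \<mu>"
      using \<mu> mult_left_mono[of 1 \<mu> "\<Sum>a\<in>R. cmod (c a)"] by (simp add: sum_nonneg)
    finally have 2: "cmod (\<Sum>a\<in>R. c a / (a - z)) \<le> (\<Sum>a\<in>R. cmod (c a)) * \<mu>" .
    have "poly s z = f z - (\<Sum>a\<in>R. c a / (a - z))"
      using f_eq[of z] nonreal[of z] Imz \<mu> by simp
    then have "cmod (poly s z) \<le> cmod (f z) + cmod (\<Sum>a\<in>R. c a / (a - z))"
      by (simp add: norm_triangle_ineq4)
    with 1 2 show ?thesis
      by (simp add: z_def[symmetric] algebra_simps)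
  qed
  from poly_linear_if_bounded[OF this] obtain c0 c1 where "s = [:c0, c1:]"
    by blast
  with f_eq show ?thesis
    by (auto simp: R_def intro!: exI)
qed

section \<open>Riemann--Stieltjes integrals of step functions\<close>

text \<open>Normalised to vanish at \<open>0\<close>, as the spectral function is.\<close>

definition jump :: "real \<Rightarrow> real \<Rightarrow> real"
  where "jump s t = of_bool (s \<le> t) - of_bool (s \<le> 0)"

text \<open>The increment over a cell {u..v} is 1 if u < s and s \<le> v, and 0 otherwise, so at
  most one cell contributes and its tag is close to s. Right-continuity of the step explains why a
  jump counts at \<open>b\<close> but not at \<open>a\<close>.\<close>

lemma has_RS_integral_jump:
  assumes cont: "isCont f s" and ab: "a \<le> b"
  shows "has_RS_integral f (\<lambda>t. of_real (jump s t)) (if a < s \<and> s \<le> b then f s else 0) a b"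
  unfolding has_RS_integral_def
proof (intro allI impI)
  fix e :: real assume e: "0 < e"
  from cont[unfolded continuous_at_eps_delta] e obtain d
    where d: "d > 0" "\<And>x. dist x s < d \<Longrightarrow> dist (f x) (f s) < e / 2"
    by (meson half_gt_zero)
  have "norm ((\<Sum>(x, K)\<in>p. f x * (of_real (jump s (Sup K)) - of_real (jump s (Inf K))))
      - (if a < s \<and> s \<le> b then f s else 0)) < e"
    if p: "p tagged_division_of {a..b}" and fine: "(\<lambda>x. ball x d) fine p" for p
  proof -
    define w where "w K = jump s (Sup K) - jump s (Inf K)" for K
    have tel: "(\<Sum>(x, K)\<in>p. w K) = jump s b - jump s a"
      unfolding w_def by (rule additive_tagged_division_1[OF ab p])
    have fs: "(if a < s \<and> s \<le> b then f s else 0) = of_real (jump s b - jump s a) * f s"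
      using ab by (auto simp: jump_def)
    have "(\<Sum>(x, K)\<in>p. f x * (of_real (jump s (Sup K)) - of_real (jump s (Inf K))))
        - (if a < s \<and> s \<le> b then f s else 0)
        = (\<Sum>(x, K)\<in>p. f x * of_real (w K)) - (\<Sum>(x, K)\<in>p. f s * of_real (w K))"
      unfolding fs tel[symmetric]
      by (simp add: w_def sum_distrib_left sum_distrib_right case_prod_unfold mult.commute)
    also have "\<dots> = (\<Sum>(x, K)\<in>p. (f x - f s) * of_real (w K))"
      by (simp add: case_prod_unfold sum_subtractf algebra_simps)
    finally have eq: "(\<Sum>(x, K)\<in>p. f x * (of_real (jump s (Sup K)) - of_real (jump s (Inf K))))
        - (if a < s \<and> s \<le> b then f s else 0) = (\<Sum>(x, K)\<in>p. (f x - f s) * of_real (w K))" .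
    have "norm (\<Sum>(x, K)\<in>p. (f x - f s) * of_real (w K)) \<le> (\<Sum>(x, K)\<in>p. e / 2 * w K)"
    proof (rule sum_norm_le, safe)
      fix x K assume xK: "(x, K) \<in> p"
      then obtain u v where K: "K = {u..v}" and x: "x \<in> K"
        using tagged_division_ofD(2,4)[OF p xK] by auto
      then have uv: "u \<le> v" by auto
      show "norm ((f x - f s) * of_real (w K)) \<le> e / 2 * w K"
      proof (cases "u < s \<and> s \<le> v")
        case True
        \<comment> \<open>Fineness puts the whole cell, hence \<open>s\<close>, into the ball around
          its tag.\<close>
        then have "s \<in> ball x d"
          using fine xK K by (fastforce simp: fine_def)
        then have "norm (f x - f s) \<le> e / 2"
          using d(2)[of x] by (simp add: dist_norm)
        moreover have "w K = 1"
          using True uv by (simp add: w_def K jump_def)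
        ultimately show ?thesis by simp
      next
        case False
        then have "w K = 0"
          using uv by (auto simp: w_def K jump_def)
        then show ?thesis by simp
      qed
    qed
    also have "\<dots> = e / 2 * (jump s b - jump s a)"
      by (simp add: tel[symmetric] sum_distrib_left case_prod_unfold)
    also have "\<dots> < e"
      using e by (auto simp: jump_def)
    finally show ?thesis
      unfolding eq .
  qed
  with d(1) show "\<exists>\<delta>>0. \<forall>p. p tagged_division_of {a..b} \<and> (\<lambda>x. ball x \<delta>) fine p \<longrightarrow>
      norm ((\<Sum>(x, K)\<in>p. f x * (of_real (jump s (Sup K)) - of_real (jump s (Inf K))))
      - (if a < s \<and> s \<le> b then f s else 0)) < e"
    by blast
qed

lemma has_RS_integral_cmult:
  assumes "has_RS_integral f g I a b"
  shows "has_RS_integral f (\<lambda>t. c * g t) (c * I) a b"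
proof (cases "c = 0")
  case False
  show ?thesis
    unfolding has_RS_integral_def
  proof (intro allI impI)
    fix e :: real assume "0 < e"
    with False have "0 < e / norm c" by simp
    with assms obtain d where d: "d > 0"
      "\<And>p. p tagged_division_of {a..b} \<and> (\<lambda>x. ball x d) fine p \<Longrightarrow>
       norm ((\<Sum>(x, K)\<in>p. f x * (g (Sup K) - g (Inf K))) - I) < e / norm c"
      unfolding has_RS_integral_def by meson
    have *: "(\<Sum>(x, K)\<in>p. f x * (c * g (Sup K) - c * g (Inf K))) - c * I
        = c * ((\<Sum>(x, K)\<in>p. f x * (g (Sup K) - g (Inf K))) - I)" for p
      by (simp add: sum_distrib_left case_prod_unfold algebra_simps sum_subtractf)
    have "norm ((\<Sum>(x, K)\<in>p. f x * (c * g (Sup K) - c * g (Inf K))) - c * I) < e"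
      if "p tagged_division_of {a..b} \<and> (\<lambda>x. ball x d) fine p" for p
      unfolding * norm_mult using d(2)[OF that] False
      by (simp add: pos_less_divide_eq mult.commute)
    with d(1) show "\<exists>d>0. \<forall>p. p tagged_division_of {a..b} \<and> (\<lambda>x. ball x d) fine p \<longrightarrow>
        norm ((\<Sum>(x, K)\<in>p. f x * (c * g (Sup K) - c * g (Inf K))) - c * I) < e"
      by blast
  qed
qed (simp add: has_RS_integral_def gt_ex)

lemma has_RS_integral_add:
  assumes "has_RS_integral f g I a b" "has_RS_integral f h J a b"
  shows "has_RS_integral f (\<lambda>t. g t + h t) (I + J) a b"
  unfolding has_RS_integral_def
proof (intro allI impI)
  fix e :: real assume "0 < e"
  then have e: "0 < e / 2" by simp
  from assms(1) e obtain d1 where d1: "d1 > 0"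
    "\<And>p. p tagged_division_of {a..b} \<Longrightarrow> (\<lambda>x. ball x d1) fine p \<Longrightarrow>
     norm ((\<Sum>(x, K)\<in>p. f x * (g (Sup K) - g (Inf K))) - I) < e / 2"
    unfolding has_RS_integral_def by meson
  from assms(2) e obtain d2 where d2: "d2 > 0"
    "\<And>p. p tagged_division_of {a..b} \<Longrightarrow> (\<lambda>x. ball x d2) fine p \<Longrightarrow>
     norm ((\<Sum>(x, K)\<in>p. f x * (h (Sup K) - h (Inf K))) - J) < e / 2"
    unfolding has_RS_integral_def by meson
  have "norm ((\<Sum>(x, K)\<in>p. f x * (g (Sup K) + h (Sup K) - (g (Inf K) + h (Inf K)))) - (I + J)) < e"
    if p: "p tagged_division_of {a..b}" and fine: "(\<lambda>x. ball x (min d1 d2)) fine p" for p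
  proof -
    have "(\<lambda>x. ball x d1) fine p" "(\<lambda>x. ball x d2) fine p"
      using fine by (fastforce simp: fine_def)+
    with d1(2) d2(2) p
    have "norm (((\<Sum>(x, K)\<in>p. f x * (g (Sup K) - g (Inf K))) - I)
        + ((\<Sum>(x, K)\<in>p. f x * (h (Sup K) - h (Inf K))) - J)) < e / 2 + e / 2"
      by (intro norm_add_less)
    then show ?thesis
      by (simp add: case_prod_unfold sum_subtractf sum.distrib algebra_simps)
  qed
  with d1(1) d2(1) show "\<exists>d>0. \<forall>p. p tagged_division_of {a..b} \<and> (\<lambda>x. ball x d) fine p \<longrightarrow>
      norm ((\<Sum>(x, K)\<in>p. f x * (g (Sup K) + h (Sup K) - (g (Inf K) + h (Inf K)))) - (I + J)) < e"
    by (intro exI[of _ "min d1 d2"]) auto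
qed

lemma has_RS_integral_sum:
  assumes "finite R" "\<And>s. s \<in> R \<Longrightarrow> has_RS_integral f (g s) (I s) a b"
  shows "has_RS_integral f (\<lambda>t. \<Sum>s\<in>R. g s t) (\<Sum>s\<in>R. I s) a b"
  using assms
proof (induction R rule: finite_induct)
  case empty
  then show ?case by (simp add: has_RS_integral_def gt_ex)
next
  case (insert s R)
  then show ?case by (simp add: has_RS_integral_add)
qed

text \<open>Once the interval contains all jumps in its half-open sense, \<open>F a b\<close> no
  longer changes, so the improper limit is that of an eventually constant function.\<close>

lemma has_RS_integral_line_step:
  assumes R: "finite R" and f: "\<And>s. s \<in> R \<Longrightarrow> isCont f s"
  shows "has_RS_integral_line f (\<lambda>t. \<Sum>s\<in>R. c s * of_real (jump s t)) (\<Sum>s\<in>R. c s * f s)"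
proof -
  define F where "F a b = (\<Sum>s\<in>R. c s * (if a < s \<and> s \<le> b then f s else 0))" for a b
  have "has_RS_integral f (\<lambda>t. \<Sum>s\<in>R. c s * of_real (jump s t)) (F a b) a b" if "a \<le> b" for a b
    unfolding F_def
    by (intro has_RS_integral_sum has_RS_integral_cmult has_RS_integral_jump R f that)
  moreover have "((\<lambda>(a, b). F a b) \<longlongrightarrow> (\<Sum>s\<in>R. c s * f s)) (at_bot \<times>\<^sub>F at_top)"
  proof (rule tendsto_eventually)
    have "\<forall>\<^sub>F a in at_bot. \<forall>s\<in>R. a < s" "\<forall>\<^sub>F b in at_top. \<forall>s\<in>R. s \<le> b"
      using R by (auto intro!: eventually_ball_finite eventually_gt_at_bot eventually_ge_at_top)
    then have "\<forall>\<^sub>F z in at_bot \<times>\<^sub>F at_top. (\<forall>s\<in>R. fst z < s) \<and> (\<forall>s\<in>R. s \<le> snd z)"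
      by (rule eventually_prodI)
    then show "\<forall>\<^sub>F z in at_bot \<times>\<^sub>F at_top. (case z of (a, b) \<Rightarrow> F a b) = (\<Sum>s\<in>R. c s * f s)"
      by eventually_elim (auto simp: F_def intro!: sum.cong)
  qed
  ultimately show ?thesis
    unfolding has_RS_integral_line_def by blast
qed

text \<open>For \<open>s > 0\<close>, \<open>jump s\<close> is the indicator of
  \<open>s \<le> t\<close>; for \<open>s \<le> 0\<close> it is minus the indicator of
  \<open>t < s\<close>. This reproduces both branches of the spectral function, including an
  eigenvalue at 0, which is counted on the negative side.\<close>

lemma spectral_fun_eq_jumps:
  assumes "finite {s::real. of_real s \<in> E}"
  shows "spectral_fun E B t $ i $ j
    = (\<Sum>s | of_real s \<in> E. (\<Sum>\<eta>\<in>B (of_real s). outer \<eta>) $ i $ j * of_real (jump s t))"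
proof -
  define P where "P s = (\<Sum>\<eta>\<in>B (complex_of_real s). outer \<eta>)" for s
  have *: "(\<Sum>s | Q s \<and> Q' s \<and> of_real s \<in> E. P s) = (\<Sum>s | of_real s \<in> E. if Q s \<and> Q' s then P s else 0)" for Q Q'
    using sum.inter_filter[OF assms, of P "\<lambda>s. Q s \<and> Q' s"]
    by (simp add: conj_commute conj_left_commute conj_assoc)
  show ?thesis
    unfolding spectral_fun_def P_def[symmetric] *
    by (auto simp: sum_component sum_negf[symmetric] jump_def intro!: sum.cong)
qed

lemma has_RS_integral_mat_spectral_fun:
  fixes B :: "complex \<Rightarrow> (complex^'n) set"
  assumes R: "finite {s::real. of_real s \<in> E}" and f: "\<And>s. isCont f s"
  shows "has_RS_integral_mat f (spectral_fun E B)
    (\<Sum>s | of_real s \<in> E. f s \<cdot> (\<Sum>\<eta>\<in>B (of_real s). outer \<eta>))"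
proof -
  define P where "P s = (\<Sum>\<eta>\<in>B (complex_of_real s). outer \<eta>)" for s
  have "(\<Sum>s | of_real s \<in> E. f s \<cdot> P s) $ i $ j = (\<Sum>s | of_real s \<in> E. P s $ i $ j * f s)" for i j
    by (simp add: sum_component mult.commute)
  then show ?thesis
    using has_RS_integral_line_step[OF R f]
    by (simp add: has_RS_integral_mat_def spectral_fun_eq_jumps[OF R] flip: P_def)
qed

section \<open>Matrix polynomials\<close>

lemma eventually_at_notin_finite: "finite R \<Longrightarrow> \<forall>\<^sub>F z in at a. z \<notin> R" for a :: complex
  by (metis islimpt_finite islimpt_iff_eventually)

text \<open>Stated for functions rather than for elements of a polynomial ring, so that products and
  determinants of parameter-dependent complex matrices are covered by closure rules.\<close>

definition polyfun :: "(complex \<Rightarrow> complex) \<Rightarrow> bool"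
  where "polyfun f \<longleftrightarrow> (\<exists>p. \<forall>z. f z = poly p z)"

lemma polyfun_const: "polyfun (\<lambda>z. c)"
  unfolding polyfun_def by (rule exI[of _ "[:c:]"]) simp

lemma polyfun_id: "polyfun (\<lambda>z. z)"
  unfolding polyfun_def by (rule exI[of _ "[:0, 1:]"]) simp

lemma polyfun_add: "polyfun f \<Longrightarrow> polyfun g \<Longrightarrow> polyfun (\<lambda>z. f z + g z)"
  unfolding polyfun_def by (metis poly_add)

lemma polyfun_mult: "polyfun f \<Longrightarrow> polyfun g \<Longrightarrow> polyfun (\<lambda>z. f z * g z)"
  unfolding polyfun_def by (metis poly_mult)

lemma polyfun_minus: "polyfun f \<Longrightarrow> polyfun (\<lambda>z. - f z)"
  unfolding polyfun_def by (metis poly_minus)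

lemma polyfun_sum: "(\<And>k. k \<in> K \<Longrightarrow> polyfun (f k)) \<Longrightarrow> polyfun (\<lambda>z. \<Sum>k\<in>K. f k z)"
  by (induction K rule: infinite_finite_induct) (simp_all add: polyfun_const polyfun_add)

lemma polyfun_prod: "(\<And>k. k \<in> K \<Longrightarrow> polyfun (f k)) \<Longrightarrow> polyfun (\<lambda>z. \<Prod>k\<in>K. f k z)"
  by (induction K rule: infinite_finite_induct) (simp_all add: polyfun_const polyfun_mult)

lemma polyfun_det: "(\<And>i j. polyfun (\<lambda>z. F z $ i $ j)) \<Longrightarrow> polyfun (\<lambda>z. det (F z))"
  unfolding det_def by (intro polyfun_sum polyfun_mult polyfun_prod polyfun_const)

lemma polyfun_matmul:
  assumes "\<And>i j. polyfun (\<lambda>z. F z $ i $ j)" "\<And>i j. polyfun (\<lambda>z. G z $ i $ j)"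
  shows "polyfun (\<lambda>z. (F z ** G z) $ i $ j)"
  unfolding matmul_nth by (intro polyfun_sum polyfun_mult assms)

lemma tendsto_matrix_iff:
  "(F \<longlongrightarrow> A) net \<longleftrightarrow> (\<forall>i j. ((\<lambda>z. F z $ i $ j) \<longlongrightarrow> A $ i $ j) net)"
  for F :: "'a \<Rightarrow> complex^'n^'m"
proof
  assume "(F \<longlongrightarrow> A) net"
  then show "\<forall>i j. ((\<lambda>z. F z $ i $ j) \<longlongrightarrow> A $ i $ j) net"
    by (intro allI tendsto_vec_nth)
next
  assume "\<forall>i j. ((\<lambda>z. F z $ i $ j) \<longlongrightarrow> A $ i $ j) net"
  then show "(F \<longlongrightarrow> A) net"
    by (intro vec_tendstoI) simp
qed

lemma tendsto_polyfun_matrix: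
  assumes "\<And>i j. polyfun (\<lambda>z. F z $ i $ j)"
  shows "(F \<longlongrightarrow> F a) (at a)"
  unfolding tendsto_matrix_iff
proof (intro allI)
  fix i j
  obtain p where "\<And>z. F z $ i $ j = poly p z"
    using assms[of i j] by (auto simp: polyfun_def)
  then show "((\<lambda>z. F z $ i $ j) \<longlongrightarrow> F a $ i $ j) (at a)"
    by (simp add: tendsto_poly)
qed

lemma tendsto_matmul:
  fixes F :: "'a \<Rightarrow> complex^'n^'m"
  assumes "(F \<longlongrightarrow> A) net" "(G \<longlongrightarrow> C) net"
  shows "((\<lambda>z. F z ** G z) \<longlongrightarrow> A ** C) net"
  using assms unfolding tendsto_matrix_iff matmul_nth by (auto intro!: tendsto_sum tendsto_mult)

lemma tendsto_mscale:
  assumes "(f \<longlongrightarrow> c) net" "(F \<longlongrightarrow> A) net"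
  shows "((\<lambda>z. f z \<cdot> F z) \<longlongrightarrow> c \<cdot> A) net"
  using assms unfolding tendsto_matrix_iff by (auto intro!: tendsto_mult)

lemma tendsto_hadj: "(F \<longlongrightarrow> A) net \<Longrightarrow> ((\<lambda>z. (F z)\<^sup>\<dagger>) \<longlongrightarrow> A\<^sup>\<dagger>) net"
  unfolding tendsto_matrix_iff by (auto intro!: tendsto_cnj)

lemma psd_limit:
  assumes lim: "(F \<longlongrightarrow> A) net" and net: "net \<noteq> bot" and psd: "\<forall>\<^sub>F z in net. psd (F z)"
  shows "psd A"
  unfolding psd_def
proof (intro conjI allI)
  have "\<forall>\<^sub>F z in net. F z = (F z)\<^sup>\<dagger>"
    using psd by eventually_elim (simp add: psd_adjoint)
  then have "(F \<longlongrightarrow> A\<^sup>\<dagger>) net"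
    using tendsto_hadj[OF lim] by (simp add: tendsto_cong)
  with lim show "A\<^sup>\<dagger> = A"
    using net tendsto_unique by blast
next
  fix x
  have "((\<lambda>z. cdot x (F z *v x)) \<longlongrightarrow> cdot x (A *v x)) net"
    using lim unfolding tendsto_matrix_iff cdot_def mv_nth
    by (auto intro!: tendsto_sum tendsto_mult)
  from tendsto_Re[OF this] show "0 \<le> Re (cdot x (A *v x))"
  proof (rule tendsto_lowerbound[OF _ _ net])
    show "\<forall>\<^sub>F z in net. 0 \<le> Re (cdot x (F z *v x))"
      using psd by eventually_elim (simp add: psd_nonneg)
  qed
qed

lemma det_eq_0_iff_kernel:
  fixes A :: "complex^'n^'n"
  shows "det A = 0 \<longleftrightarrow> (\<exists>x. x \<noteq> 0 \<and> A *v x = 0)"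
  using invertible_det_nz[of A] invertible_left_inverse[of A] matrix_left_invertible_ker[of A]
  by metis

section \<open>The Weyl--Titchmarsh function\<close>

text \<open>Inserting the resolution of the identity into the J-bracket expresses it by the two
  boundary values \<open>\<beta> ** Z\<close> and \<open>\<beta> ** JJ ** Z\<close>. It is used with
  \<alpha> at index 0 and with \<beta> at index N + 1, where one of the values is often
  known.\<close>

lemma \<Gamma>_bracket:
  fixes \<beta> :: "complex^('n::finite + 'n)^'n"
  assumes "\<beta> \<in> \<Gamma>"
  shows "Z\<^sup>\<dagger> ** JJ ** X = (\<beta> ** Z)\<^sup>\<dagger> ** (\<beta> ** JJ ** X) - (\<beta> ** JJ ** Z)\<^sup>\<dagger> ** (\<beta> ** X)"
proof -
  have JJ_JJ': "Y ** JJ ** JJ = - Y" for Y :: "complex^('n + 'n)^'k"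
    by (simp add: JJ_JJ matmul_minus_right flip: matrix_mul_assoc)
  have "Z\<^sup>\<dagger> ** JJ ** X = Z\<^sup>\<dagger> ** (\<beta>\<^sup>\<dagger> ** \<beta> - JJ ** \<beta>\<^sup>\<dagger> ** \<beta> ** JJ) ** JJ ** X"
    by (simp add: \<Gamma>_resolution[OF assms])
  also have "\<dots> = (\<beta> ** Z)\<^sup>\<dagger> ** (\<beta> ** JJ ** X) - (\<beta> ** JJ ** Z)\<^sup>\<dagger> ** (\<beta> ** X)"
    by (simp add: matrix_algebra JJ_hadj JJ_JJ')
  finally show ?thesis .
qed

locale symplectic_system =
  fixes S \<Psi> :: "nat \<Rightarrow> complex^('n::finite + 'n)^('n + 'n)"
    and N :: nat
    and \<alpha> \<beta> :: "complex^('n + 'n)^'n"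
    and Zh Zt :: "complex \<Rightarrow> nat \<Rightarrow> complex^'n^('n + 'n)"
  assumes S_symplectic: "\<And>k. k \<le> N \<Longrightarrow> (S k)\<^sup>\<dagger> ** JJ ** S k = JJ"
    and \<Psi>_psd: "\<And>k. k \<le> N \<Longrightarrow> psd (\<Psi> k)"
    and \<Psi>_J: "\<And>k. k \<le> N \<Longrightarrow> (\<Psi> k)\<^sup>\<dagger> ** JJ ** \<Psi> k = 0"
    and \<alpha>: "\<alpha> \<in> \<Gamma>" and \<beta>: "\<beta> \<in> \<Gamma>"
    and Zh: "\<And>\<nu>. mat_solution S \<Psi> N \<nu> (Zh \<nu>)" "\<And>\<nu>. Zh \<nu> 0 = \<alpha>\<^sup>\<dagger>"
    and Zt: "\<And>\<nu>. mat_solution S \<Psi> N \<nu> (Zt \<nu>)" "\<And>\<nu>. Zt \<nu> 0 = - (JJ ** \<alpha>\<^sup>\<dagger>)"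
    and Atkinson: "weak_Atkinson \<Psi> N Zt"
begin

abbreviation "D \<nu> \<equiv> \<beta> ** Zt \<nu> (N + 1)"
abbreviation "W \<equiv> weyl_M N \<beta> Zh Zt"

section \<open>Lagrange's identity for the system\<close>

lemma JJ_JJ_right: "Y ** JJ ** JJ = - Y" for Y :: "complex^('n + 'n)^'k"
  by (simp add: JJ_JJ matmul_minus_right flip: matrix_mul_assoc)

lemma \<Psi>_JJ_\<Psi>: "k \<le> N \<Longrightarrow> \<Psi> k ** JJ ** \<Psi> k = 0"
  using \<Psi>_J \<Psi>_psd psd_adjoint by metis

lemma \<Psi>_JJ_\<Psi>_right: "k \<le> N \<Longrightarrow> Y ** \<Psi> k ** JJ ** \<Psi> k = 0" for Y :: "complex^('n + 'n)^'k"
  by (metis \<Psi>_JJ_\<Psi> matrix_mul_assoc times0_right)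

text \<open>The perturbation of \<open>S k\<close> starts with \<open>JJ ** \<Psi> k\<close>, which
  \<open>\<Psi> k\<close> annihilates from the left; the weight thus does not see the spectral
  parameter.\<close>

lemma \<Psi>_sys_mat: "k \<le> N \<Longrightarrow> \<Psi> k ** sys_mat S \<Psi> \<nu> k = \<Psi> k ** S k"
  by (simp add: sys_mat_def matrix_algebra \<Psi>_JJ_\<Psi>)

text \<open>The constant term is J by symplecticity, the two linear terms combine to the factor
  \<open>\<nu> - cnj \<mu>\<close>, and the product of the two perturbations contains \<Psi> J
  \<Psi> and vanishes.\<close>

lemma sys_mat_form:
  assumes "k \<le> N"
  shows "(sys_mat S \<Psi> \<mu> k)\<^sup>\<dagger> ** JJ ** sys_mat S \<Psi> \<nu> k
    = JJ + (\<nu> - cnj \<mu>) \<cdot> ((S k)\<^sup>\<dagger> ** \<Psi> k ** S k)"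
  using assms
  by (simp add: sys_mat_def matrix_algebra JJ_hadj S_symplectic psd_adjoint[OF \<Psi>_psd] JJ_JJ_right
      \<Psi>_JJ_\<Psi>_right mscale_diff_left)

text \<open>The semi-inner product of solutions with weights \<Psi> k, taken between columns. The
  index N + 1 carries no weight and enters only through boundary terms.\<close>

definition form :: "(nat \<Rightarrow> complex^'n^('n + 'n)) \<Rightarrow> (nat \<Rightarrow> complex^'n^('n + 'n)) \<Rightarrow> complex^'n^'n"
  where "form U Z = (\<Sum>k=0..N. (U k)\<^sup>\<dagger> ** \<Psi> k ** Z k)"

lemma gram_eq_form: "gram \<Psi> N Zt \<nu> = form (Zt \<nu>) (Zt \<nu>)"
  by (simp add: gram_def form_def)

lemma psd_form: "psd (form U U)"
  unfolding form_def by (intro psd_sum psd_conj \<Psi>_psd) simp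

text \<open>\<open>sys_mat_form\<close> yields the weight
  \<open>(S k)\<^sup>\<dagger> ** \<Psi> k ** S k\<close> between values at k + 1; since \<Psi> k
  ignores the parameter, this is the weight \<Psi> k between values at k.\<close>

lemma lagrange_step:
  assumes U: "mat_solution S \<Psi> N \<mu> U" and Z: "mat_solution S \<Psi> N \<nu> Z" and k: "k \<le> N"
  shows "(U k)\<^sup>\<dagger> ** JJ ** Z k
    = (U (k + 1))\<^sup>\<dagger> ** JJ ** Z (k + 1) + (\<nu> - cnj \<mu>) \<cdot> ((U k)\<^sup>\<dagger> ** \<Psi> k ** Z k)"
proof -
  define s where "s \<nu> = sys_mat S \<Psi> \<nu> k" for \<nu>
  have U_k: "U k = s \<mu> ** U (k + 1)" and Z_k: "Z k = s \<nu> ** Z (k + 1)"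
    using U Z k by (auto simp: mat_solution_def s_def)
  have "(s \<mu>)\<^sup>\<dagger> ** \<Psi> k = (\<Psi> k ** s \<mu>)\<^sup>\<dagger>"
    by (simp add: hadj_mult psd_adjoint[OF \<Psi>_psd[OF k]])
  also have "\<dots> = (S k)\<^sup>\<dagger> ** \<Psi> k"
    by (simp add: s_def \<Psi>_sys_mat[OF k] hadj_mult psd_adjoint[OF \<Psi>_psd[OF k]])
  finally have s\<Psi>: "(s \<mu>)\<^sup>\<dagger> ** \<Psi> k = (S k)\<^sup>\<dagger> ** \<Psi> k" .
  have s\<Psi>s: "(s \<mu>)\<^sup>\<dagger> ** \<Psi> k ** s \<nu> = (S k)\<^sup>\<dagger> ** \<Psi> k ** S k"
    by (metis s\<Psi> \<Psi>_sys_mat[OF k] s_def matrix_mul_assoc)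
  have "(U k)\<^sup>\<dagger> ** JJ ** Z k = (U (k + 1))\<^sup>\<dagger> ** ((s \<mu>)\<^sup>\<dagger> ** JJ ** s \<nu>) ** Z (k + 1)"
    by (simp add: U_k Z_k hadj_mult matrix_mul_assoc)
  moreover have "(U k)\<^sup>\<dagger> ** \<Psi> k ** Z k = (U (k + 1))\<^sup>\<dagger> ** ((s \<mu>)\<^sup>\<dagger> ** \<Psi> k ** s \<nu>) ** Z (k + 1)"
    by (simp add: U_k Z_k hadj_mult matrix_mul_assoc)
  ultimately show ?thesis
    using sys_mat_form[OF k, of \<mu> \<nu>]
    by (simp add: s\<Psi>s flip: s_def) (simp add: matrix_algebra)
qed

lemma lagrange:
  assumes U: "mat_solution S \<Psi> N \<mu> U" and Z: "mat_solution S \<Psi> N \<nu> Z"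
  shows "(U 0)\<^sup>\<dagger> ** JJ ** Z 0 - (U (N + 1))\<^sup>\<dagger> ** JJ ** Z (N + 1) = (\<nu> - cnj \<mu>) \<cdot> form U Z"
proof -
  have "(U 0)\<^sup>\<dagger> ** JJ ** Z 0 = (U m)\<^sup>\<dagger> ** JJ ** Z m
      + (\<nu> - cnj \<mu>) \<cdot> (\<Sum>k<m. (U k)\<^sup>\<dagger> ** \<Psi> k ** Z k)" if "m \<le> N + 1" for m
    using that
  proof (induction m)
    case 0
    then show ?case by simp
  next
    case (Suc m)
    then show ?case
      using lagrange_step[OF U Z, of m] by (simp add: mscale_add add_ac)
  qed
  from this[of "N + 1"] show ?thesis
    by (simp add: form_def atLeast0AtMost lessThan_Suc_atMost)
qed

section \<open>The forward recursion, positivity and eigenvalues\<close>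

definition sys_inv :: "complex \<Rightarrow> nat \<Rightarrow> complex^('n + 'n)^('n + 'n)"
  where "sys_inv \<nu> k = - (JJ ** (S k)\<^sup>\<dagger> ** JJ) ** (mat 1 + \<nu> \<cdot> (JJ ** \<Psi> k))"

text \<open>The system matrix factors as \<open>mat 1 - \<nu> \<cdot> (JJ ** \<Psi> k)\<close> times
  \<open>S k\<close>. The first factor is inverted by changing the sign of \<nu>, because
  \<open>JJ ** \<Psi> k\<close> squares to 0; the inverse of the second is
  \<open>- (JJ ** (S k)\<^sup>\<dagger> ** JJ)\<close> by symplecticity.\<close>

lemma sys_inv_sys_mat:
  assumes k: "k \<le> N"
  shows "sys_inv \<nu> k ** sys_mat S \<Psi> \<nu> k = mat 1"
proof -
  have "(mat 1 + \<nu> \<cdot> (JJ ** \<Psi> k)) ** sys_mat S \<Psi> \<nu> k = S k"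
    by (simp add: sys_mat_def matrix_algebra \<Psi>_JJ_\<Psi>_right[OF k])
  then have "sys_inv \<nu> k ** sys_mat S \<Psi> \<nu> k = - (JJ ** ((S k)\<^sup>\<dagger> ** JJ ** S k))"
    by (simp add: sys_inv_def matmul_minus_left flip: matrix_mul_assoc)
  also have "\<dots> = mat 1"
    by (simp add: S_symplectic[OF k] JJ_JJ)
  finally show ?thesis .
qed

lemma mat_solution_Suc:
  assumes "mat_solution S \<Psi> N \<nu> Z" "k \<le> N"
  shows "Z (Suc k) = sys_inv \<nu> k ** Z k"
  using assms sys_inv_sys_mat[of k \<nu>] by (simp add: mat_solution_def matrix_mul_assoc)

lemma vec_solution_Suc:
  assumes "vec_solution S \<Psi> N \<nu> z" "k \<le> N"
  shows "z (Suc k) = sys_inv \<nu> k *v z k"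
  using assms sys_inv_sys_mat[of k \<nu>] by (simp add: vec_solution_def matrix_vector_mul_assoc)

lemma \<alpha>_initial:
  "\<alpha> ** Zt \<nu> 0 = 0" "\<alpha> ** JJ ** Zt \<nu> 0 = mat 1" "\<alpha> ** Zh \<nu> 0 = mat 1" "\<alpha> ** JJ ** Zh \<nu> 0 = 0"
  using \<Gamma>_adjoint_mult[OF \<alpha>] by (simp_all add: Zh Zt matrix_algebra JJ_JJ_right)

text \<open>This extends the Atkinson condition from one parameter to every parameter. If the energy
  of a solution vanished at \<nu>, each \<Psi> k would annihilate it; the same sequence would then
  solve the system on 0, ..., N for all parameters, with zero energy at the one where positivity is
  assumed.\<close>

lemma gram_pos:
  assumes \<eta>: "\<eta> \<noteq> 0"
  shows "0 < Re (cdot \<eta> (gram \<Psi> N Zt \<nu> *v \<eta>))"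
proof (rule ccontr)
  define q where "q \<nu> k = cdot (Zt \<nu> k *v \<eta>) (\<Psi> k *v (Zt \<nu> k *v \<eta>))" for \<nu> k
  have q_nonneg: "0 \<le> Re (q \<nu> k)" if "k \<le> N" for \<nu> k
    unfolding q_def by (intro psd_nonneg \<Psi>_psd that)
  have "cdot \<eta> (gram \<Psi> N Zt \<nu> *v \<eta>) = (\<Sum>k=0..N. q \<nu> k)"
    by (simp add: gram_def mv_sum_left cdot_sum_right q_def cdot_adjoint matrix_vector_mul_assoc hadj_mult
        matrix_mul_assoc)
  moreover assume "\<not> 0 < Re (cdot \<eta> (gram \<Psi> N Zt \<nu> *v \<eta>))"
  moreover have "0 \<le> (\<Sum>k=0..N. Re (q \<nu> k))"
    by (intro sum_nonneg q_nonneg) simp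
  ultimately have "(\<Sum>k=0..N. Re (q \<nu> k)) = 0"
    by simp
  then have "Re (q \<nu> k) = 0" if "k \<le> N" for k
    using that q_nonneg by (subst (asm) sum_nonneg_eq_0_iff) auto
  then have \<Psi>0: "\<Psi> k *v (Zt \<nu> k *v \<eta>) = 0" if "k \<le> N" for k
    using that psd_kernel[OF \<Psi>_psd[OF that]] by (simp add: q_def)
  \<comment> \<open>On the kernel of \<open>\<Psi> k\<close> the forward step is independent of the
    parameter.\<close>
  have step: "sys_inv \<mu> k *v x = - (JJ ** (S k)\<^sup>\<dagger> ** JJ) *v x" if "\<Psi> k *v x = 0" for \<mu> k x
    using that
    by (simp add: sys_inv_def matrix_vector_right_distrib matrix_vector_mult_add_rdistrib mv_mscale
        flip: matrix_vector_mul_assoc)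
  have same: "Zt \<mu> k *v \<eta> = Zt \<nu> k *v \<eta>" if "k \<le> N" for \<mu> k
    using that
  proof (induction k)
    case 0
    then show ?case by (simp add: Zt)
  next
    case (Suc k)
    then have k: "k \<le> N" and IH: "Zt \<mu> k *v \<eta> = Zt \<nu> k *v \<eta>" by auto
    have "Zt \<kappa> (Suc k) *v \<eta> = sys_inv \<kappa> k *v (Zt \<kappa> k *v \<eta>)" for \<kappa>
      using mat_solution_Suc[OF Zt(1) k] by (simp add: matrix_vector_mul_assoc)
    then show ?case
      by (simp add: IH step[OF \<Psi>0[OF k]])
  qed
  obtain \<mu> where "0 < Re (\<Sum>k=0..N. q \<mu> k)"
    using Atkinson \<eta> by (auto simp: weak_Atkinson_def q_def)
  moreover have "(\<Sum>k=0..N. q \<mu> k) = 0"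
    by (intro sum.neutral) (simp add: q_def same[of _ \<mu>] \<Psi>0)
  ultimately show False
    by simp
qed

lemma is_eigenvalue_iff_det: "is_eigenvalue S \<Psi> N \<alpha> \<beta> \<nu> \<longleftrightarrow> det (D \<nu>) = 0"
proof
  assume "is_eigenvalue S \<Psi> N \<alpha> \<beta> \<nu>"
  then obtain z k where z: "vec_solution S \<Psi> N \<nu> z" "\<alpha> *v z 0 = 0" "\<beta> *v z (N + 1) = 0"
    and k: "k \<le> N + 1" "z k \<noteq> 0"
    by (auto simp: is_eigenvalue_def)
  define \<eta> where "\<eta> = (\<alpha> ** JJ) *v z 0"
  \<comment> \<open>With \<open>\<alpha> *v z 0 = 0\<close> only the second summand of the
    resolution survives, so \<open>z 0\<close> lies in the range of the initial value of
    \<open>Zt\<close>.\<close>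
  have "z 0 = (\<alpha>\<^sup>\<dagger> ** \<alpha> - JJ ** \<alpha>\<^sup>\<dagger> ** \<alpha> ** JJ) *v z 0"
    by (simp add: \<Gamma>_resolution[OF \<alpha>])
  also have "\<dots> = Zt \<nu> 0 *v \<eta>"
    by (simp add: \<eta>_def Zt matrix_vector_mult_diff_rdistrib mv_minus_left z(2)
        flip: matrix_vector_mul_assoc)
  finally have z0: "z 0 = Zt \<nu> 0 *v \<eta>" .
  have z_eq: "z k = Zt \<nu> k *v \<eta>" if "k \<le> N + 1" for k
    using that
  proof (induction k)
    case (Suc k)
    then show ?case
      using vec_solution_Suc[OF z(1), of k] mat_solution_Suc[OF Zt(1), of k \<nu>]
      by (simp add: matrix_vector_mul_assoc)
  qed (rule z0)
  have "\<eta> \<noteq> 0"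
    using k z_eq by auto
  moreover have "D \<nu> *v \<eta> = 0"
    using z(3) z_eq[of "N + 1"] by (simp add: matrix_vector_mul_assoc)
  ultimately show "det (D \<nu>) = 0"
    by (auto simp: det_eq_0_iff_kernel)
next
  assume "det (D \<nu>) = 0"
  then obtain \<eta> where \<eta>: "\<eta> \<noteq> 0" "D \<nu> *v \<eta> = 0"
    by (auto simp: det_eq_0_iff_kernel)
  have "(\<alpha> ** JJ) *v (Zt \<nu> 0 *v \<eta>) = \<eta>"
    by (simp add: matrix_vector_mul_assoc \<alpha>_initial)
  with \<eta>(1) have "Zt \<nu> 0 *v \<eta> \<noteq> 0"
    by auto
  moreover have "vec_solution S \<Psi> N \<nu> (\<lambda>k. Zt \<nu> k *v \<eta>)"
    using Zt(1)[of \<nu>] by (auto simp: vec_solution_def mat_solution_def matrix_vector_mul_assoc)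
  ultimately show "is_eigenvalue S \<Psi> N \<alpha> \<beta> \<nu>"
    using \<eta>(2) unfolding is_eigenvalue_def
    by (intro exI[of _ "\<lambda>k. Zt \<nu> k *v \<eta>"]) (auto simp: matrix_vector_mul_assoc \<alpha>_initial)
qed

text \<open>For a kernel vector \<eta> of \<open>D \<nu>\<close> the brackets at both ends vanish in
  Lagrange's identity with \<mu> = \<nu>, leaving \<open>\<nu> - cnj \<nu>\<close> times a positive
  energy.\<close>

lemma det_D_nonzero:
  assumes "\<nu> \<notin> \<real>"
  shows "det (D \<nu>) \<noteq> 0"
proof
  assume "det (D \<nu>) = 0"
  then obtain \<eta> where \<eta>: "\<eta> \<noteq> 0" "D \<nu> *v \<eta> = 0"
    by (auto simp: det_eq_0_iff_kernel)
  define Y where "Y = \<beta> ** JJ ** Zt \<nu> (N + 1)"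
  have "- ((D \<nu>)\<^sup>\<dagger> ** Y - Y\<^sup>\<dagger> ** D \<nu>) = (\<nu> - cnj \<nu>) \<cdot> gram \<Psi> N Zt \<nu>"
    using lagrange[OF Zt(1) Zt(1), of \<nu> \<nu>]
    by (simp add: \<Gamma>_bracket[OF \<alpha>, of "Zt \<nu> 0"] \<Gamma>_bracket[OF \<beta>, of "Zt \<nu> (Suc N)"] \<alpha>_initial Y_def
        gram_eq_form)
  then have "cdot \<eta> (- ((D \<nu>)\<^sup>\<dagger> ** Y - Y\<^sup>\<dagger> ** D \<nu>) *v \<eta>) = cdot \<eta> (((\<nu> - cnj \<nu>) \<cdot> gram \<Psi> N Zt \<nu>) *v \<eta>)"
    by simp
  moreover have "cdot \<eta> (((D \<nu>)\<^sup>\<dagger> ** Y) *v \<eta>) = 0"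
    using \<eta>(2) by (simp add: cdot_adjoint flip: matrix_vector_mul_assoc)
  moreover have "(Y\<^sup>\<dagger> ** D \<nu>) *v \<eta> = 0"
    using \<eta>(2) by (metis matrix_vector_mul_assoc matrix_vector_mult_0_right)
  ultimately have 0: "(\<nu> - cnj \<nu>) * cdot \<eta> (gram \<Psi> N Zt \<nu> *v \<eta>) = 0"
    by (simp add: mv_mscale cdot_scale mv_minus_left matrix_vector_mult_diff_rdistrib cdot_minus
        cdot_diff mscale_diff_left left_diff_distrib)
  have "\<nu> - cnj \<nu> \<noteq> 0"
    using assms by (auto simp: complex_eq_iff complex_is_Real_iff)
  with 0 gram_pos[OF \<eta>(1), of \<nu>] show False
    by simp
qed

text \<open>The forward step \<open>sys_inv\<close> is affine in \<nu> and the initial value does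
  not depend on \<nu>.\<close>

lemma polyfun_solution:
  assumes Z: "\<And>\<nu>. mat_solution S \<Psi> N \<nu> (Z \<nu>)" "\<And>\<nu>. Z \<nu> 0 = Z0"
  shows "k \<le> N + 1 \<Longrightarrow> polyfun (\<lambda>\<nu>. Z \<nu> k $ i $ j)"
proof (induction k arbitrary: i j)
  case 0
  then show ?case by (simp add: Z polyfun_const)
next
  case (Suc k)
  then have k: "k \<le> N" by simp
  have "polyfun (\<lambda>\<nu>. (mat 1 + \<nu> \<cdot> (JJ ** \<Psi> k)) $ i $ j)" for i j
    by (simp add: polyfun_add polyfun_const polyfun_mult polyfun_id)
  with Suc show ?case
    by (simp add: mat_solution_Suc[OF Z(1) k] sys_inv_def polyfun_matmul polyfun_const)
qed

lemma polyfun_D: "polyfun (\<lambda>\<nu>. D \<nu> $ i $ j)"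
  by (intro polyfun_matmul polyfun_const polyfun_solution[OF Zt]) simp

lemma polyfun_\<beta>_Zh: "polyfun (\<lambda>\<nu>. (\<beta> ** Zh \<nu> (N + 1)) $ i $ j)"
  by (intro polyfun_matmul polyfun_const polyfun_solution[OF Zh]) simp

lemma finite_eigenvalues: "finite {\<nu>. det (D \<nu>) = 0}"
proof -
  obtain p where p: "\<And>\<nu>. det (D \<nu>) = poly p \<nu>"
    using polyfun_det[OF polyfun_D] by (auto simp: polyfun_def)
  have "\<i> \<notin> \<real>"
    by (simp add: complex_is_Real_iff)
  then have "p \<noteq> 0"
    using det_D_nonzero[of \<i>] p by auto
  then show ?thesis
    unfolding p by (rule poly_roots_finite)
qed

lemma D_weyl:
  assumes "det (D \<nu>) \<noteq> 0"
  shows "D \<nu> ** W \<nu> = - (\<beta> ** Zh \<nu> (N + 1))"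
proof -
  have "D \<nu> ** matrix_inv (D \<nu>) = mat 1"
    using assms unfolding matrix_inv_def invertible_det_nz[symmetric] invertible_def
    by (metis (mono_tags, lifting) someI_ex)
  then show ?thesis
    by (simp add: weyl_M_def matmul_minus_right matrix_mul_assoc)
qed

text \<open>Cramer's rule for column j of
  \<open>D \<nu> ** W \<nu> = - (\<beta> ** Zh \<nu> (N + 1))\<close>: the numerator is the
  determinant of \<open>D \<nu>\<close> with column i replaced, again a polynomial.\<close>

lemma weyl_rational:
  "\<exists>q. \<forall>\<nu>. det (D \<nu>) \<noteq> 0 \<longrightarrow> W \<nu> $ i $ j * det (D \<nu>) = poly q \<nu>"
proof -
  define b where "b \<nu> = - column j (\<beta> ** Zh \<nu> (N + 1))" for \<nu>
  define C where "C \<nu> = (\<chi> k l. if l = i then b \<nu> $ k else D \<nu> $ k $ l)" for \<nu>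
  have "polyfun (\<lambda>\<nu>. C \<nu> $ k $ l)" for k l
    using polyfun_D polyfun_\<beta>_Zh
    by (cases "l = i") (simp_all add: C_def b_def column_def polyfun_minus)
  then obtain q where q: "\<And>\<nu>. det (C \<nu>) = poly q \<nu>"
    using polyfun_det[of C] by (auto simp: polyfun_def)
  have "W \<nu> $ i $ j * det (D \<nu>) = poly q \<nu>" if d: "det (D \<nu>) \<noteq> 0" for \<nu>
  proof -
    have "D \<nu> *v column j (W \<nu>) = b \<nu>"
      using D_weyl[OF d] by (simp add: vec_eq_iff b_def column_def mv_nth matmul_nth)
    then have "column j (W \<nu>) $ i = det (C \<nu>) / det (D \<nu>)"
      unfolding cramer[OF d] by (simp add: C_def)
    with d show ?thesis
      by (simp add: q column_def)
  qed
  then show ?thesis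
    by blast
qed

section \<open>The Weyl solution and the growth of M\<close>

definition X :: "complex \<Rightarrow> nat \<Rightarrow> complex^'n^('n + 'n)"
  where "X \<nu> k = Zh \<nu> k + Zt \<nu> k ** W \<nu>"

lemma X_solution: "mat_solution S \<Psi> N \<nu> (X \<nu>)"
  using Zh(1)[of \<nu>] Zt(1)[of \<nu>]
  by (simp add: mat_solution_def X_def matrix_add_ldistrib matrix_mul_assoc)

lemma X_boundary:
  "\<alpha> ** X \<nu> 0 = mat 1" "\<alpha> ** JJ ** X \<nu> 0 = W \<nu>"
  "det (D \<nu>) \<noteq> 0 \<Longrightarrow> \<beta> ** X \<nu> (Suc N) = 0"
  using D_weyl[of \<nu>] by (simp_all add: X_def matrix_add_ldistrib matrix_mul_assoc \<alpha>_initial)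

text \<open>Both Weyl solutions satisfy the condition at N + 1, so that bracket vanishes; at 0 their
  boundary values are the identity and W, which gives the left side.\<close>

lemma weyl_diff:
  assumes "det (D \<mu>) \<noteq> 0" "det (D \<nu>) \<noteq> 0"
  shows "W \<nu> - (W \<mu>)\<^sup>\<dagger> = (\<nu> - cnj \<mu>) \<cdot> form (X \<mu>) (X \<nu>)"
  using lagrange[OF X_solution X_solution, of \<mu> \<nu>] assms
  by (simp add: \<Gamma>_bracket[OF \<alpha>, of "X \<mu> 0"] \<Gamma>_bracket[OF \<beta>, of "X \<mu> (Suc N)"] X_boundary)

text \<open>Prepared for \<mu> an eigenvalue: the unknown boundary value of \<open>X \<nu>\<close>
  carries the factor \<open>(D \<mu>)\<^sup>\<dagger>\<close>, which can be killed from the left by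
  vectors in the kernel of \<open>D \<mu>\<close>.\<close>

lemma Zt_X_form:
  assumes "det (D \<nu>) \<noteq> 0"
  shows "(cnj \<mu> - \<nu>) \<cdot> form (Zt \<mu>) (X \<nu>) = mat 1 + (D \<mu>)\<^sup>\<dagger> ** (\<beta> ** JJ ** X \<nu> (N + 1))"
proof -
  have "- mat 1 - (D \<mu>)\<^sup>\<dagger> ** (\<beta> ** JJ ** X \<nu> (N + 1)) = (\<nu> - cnj \<mu>) \<cdot> form (Zt \<mu>) (X \<nu>)"
    using lagrange[OF Zt(1) X_solution, of \<mu> \<nu>] assms
    by (simp add: \<Gamma>_bracket[OF \<alpha>, of "Zt \<mu> 0"] \<Gamma>_bracket[OF \<beta>, of "Zt \<mu> (Suc N)"] X_boundary
        \<alpha>_initial)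
  then show ?thesis
    by (simp add: mscale_diff_left algebra_simps)
qed

lemma form_bound:
  assumes s: "0 < s"
  shows "2 * cmod (form U Z $ i $ j) \<le> Re (form U U $ i $ i) / s + s * Re (form Z Z $ j $ j)"
proof -
  define e :: "'n \<Rightarrow> complex^'n" where "e i = axis i 1" for i
  have nth: "form U Z $ i $ j = (\<Sum>k=0..N. cdot (U k *v e i) (\<Psi> k *v (Z k *v e j)))" for U Z i j
    by (simp add: form_def sum_component cdot_axis[symmetric] e_def cdot_adjoint matrix_vector_mul_assoc
        hadj_mult matrix_mul_assoc)
  have "2 * cmod (form U Z $ i $ j) \<le> (\<Sum>k=0..N. 2 * cmod (cdot (U k *v e i) (\<Psi> k *v (Z k *v e j))))"
    unfolding nth sum_distrib_left[symmetric] by (intro mult_left_mono norm_sum) auto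
  also have "\<dots> \<le> (\<Sum>k=0..N. Re (cdot (U k *v e i) (\<Psi> k *v (U k *v e i))) / s
      + s * Re (cdot (Z k *v e j) (\<Psi> k *v (Z k *v e j))))"
    by (intro sum_mono psd_form_bound \<Psi>_psd s) simp
  finally show ?thesis
    by (simp add: nth sum.distrib sum_distrib_left sum_divide_distrib)
qed

lemma weyl_bound:
  "\<exists>K. \<forall>\<nu>. \<nu> \<notin> \<real> \<longrightarrow> cmod (W \<nu> $ i $ j) \<le> K * (1 + (cmod (\<nu> + \<i>))\<^sup>2 / \<bar>Im \<nu>\<bar>)"
proof -
  define a where "a i = Re (form (X \<i>) (X \<i>) $ i $ i)" for i
  have a: "a i \<ge> 0" for i
    unfolding a_def by (intro psd_diagonal psd_form)
  have ii: "det (D \<i>) \<noteq> 0"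
    by (rule det_D_nonzero) (simp add: complex_is_Real_iff)
  have half: "cmod (W \<nu> $ i $ j)
      \<le> cmod (W \<i> $ j $ i) + (cmod (\<nu> + \<i>))\<^sup>2 / \<bar>Im \<nu>\<bar> * a i / 2 + cmod (W \<nu> $ j $ j) / 2"
    if \<nu>: "\<nu> \<notin> \<real>" for \<nu> i j
  proof -
    define w where "w = cmod (\<nu> + \<i>)"
    define y where "y = \<bar>Im \<nu>\<bar>"
    define F where "F = form (X \<i>) (X \<nu>) $ i $ j"
    define b where "b = Re (form (X \<nu>) (X \<nu>) $ j $ j)"
    have y: "y > 0" using \<nu> by (auto simp: y_def complex_is_Real_iff)
    have w: "w \<ge> 0" by (simp add: w_def)
    have d: "det (D \<nu>) \<noteq> 0" using \<nu> by (rule det_D_nonzero)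
    have "(W \<nu> - (W \<nu>)\<^sup>\<dagger>) $ j $ j = ((\<nu> - cnj \<nu>) \<cdot> form (X \<nu>) (X \<nu>)) $ j $ j"
      using weyl_diff[OF d d] by simp
    then have "Im (W \<nu> $ j $ j - cnj (W \<nu> $ j $ j)) = Im ((\<nu> - cnj \<nu>) * form (X \<nu>) (X \<nu>) $ j $ j)"
      by simp
    then have "Im (W \<nu> $ j $ j) = Im \<nu> * b"
      by (simp add: b_def)
    moreover have "b \<ge> 0"
      unfolding b_def by (intro psd_diagonal psd_form)
    ultimately have yb: "y * b \<le> cmod (W \<nu> $ j $ j)"
      using abs_Im_le_cmod[of "W \<nu> $ j $ j"] by (simp add: y_def abs_mult)
    have wF: "w * cmod F \<le> w\<^sup>2 / y * a i / 2 + y * b / 2"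
    proof (cases "w = 0")
      case True
      then show ?thesis using y \<open>b \<ge> 0\<close> by simp
    next
      case False
      \<comment> \<open>This choice makes the coefficient of \<open>b\<close> equal to
        \<open>y\<close> after multiplication by \<open>w\<close>, and \<open>y * b\<close> is at
        most \<open>cmod (W \<nu> $ j $ j)\<close>. The excluded case \<open>w = 0\<close> is \<nu>
        = -i.\<close>
      with w y have s: "0 < y / w" by simp
      have "w * (2 * cmod F) \<le> w * (a i / (y / w) + y / w * b)"
        using form_bound[OF s, of "X \<i>" "X \<nu>" i j] w
        by (intro mult_left_mono) (simp_all add: F_def a_def b_def)
      also have "\<dots> = w\<^sup>2 / y * a i + y * b"
        using False y by (simp add: field_simps power2_eq_square)
      finally show ?thesis by simp
    qed
    have "(W \<nu> - (W \<i>)\<^sup>\<dagger>) $ i $ j = ((\<nu> - cnj \<i>) \<cdot> form (X \<i>) (X \<nu>)) $ i $ j"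
      using weyl_diff[OF ii d] by simp
    then have "W \<nu> $ i $ j = cnj (W \<i> $ j $ i) + (\<nu> + \<i>) * F"
      by (simp add: F_def algebra_simps)
    then have "cmod (W \<nu> $ i $ j) \<le> cmod (W \<i> $ j $ i) + w * cmod F"
      using norm_triangle_ineq[of "cnj (W \<i> $ j $ i)" "(\<nu> + \<i>) * F"] by (simp add: norm_mult w_def)
    with wF yb show ?thesis
      by (simp add: w_def y_def)
  qed
  \<comment> \<open>The estimate for (j, j) gives \<open>cmod (W \<nu> $ j $ j)\<close> at most
    \<open>2 * cmod (W \<i> $ j $ j) + r * a j\<close>, with \<open>r\<close> the quotient in the
    claim; inserting it into the estimate for (i, j) leaves these four constants.\<close>
  define K where "K = cmod (W \<i> $ j $ i) + cmod (W \<i> $ j $ j) + a i + a j"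
  have "cmod (W \<nu> $ i $ j) \<le> K * (1 + (cmod (\<nu> + \<i>))\<^sup>2 / \<bar>Im \<nu>\<bar>)" if "\<nu> \<notin> \<real>" for \<nu>
  proof -
    define r where "r = (cmod (\<nu> + \<i>))\<^sup>2 / \<bar>Im \<nu>\<bar>"
    have r: "r \<ge> 0" by (simp add: r_def)
    have "cmod (W \<nu> $ i $ j) \<le> cmod (W \<i> $ j $ i) + cmod (W \<i> $ j $ j) + r * a i + r * a j"
      using half[OF that, of i j] half[OF that, of j j] mult_nonneg_nonneg[OF r a[of i]]
        mult_nonneg_nonneg[OF r a[of j]]
      unfolding r_def[symmetric] by linarith
    also have "\<dots> \<le> K * (1 + r)"
      using r a[of i] a[of j] by (simp add: K_def algebra_simps add_nonneg_nonneg)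
    finally show ?thesis
      by (simp add: r_def)
  qed
  then show ?thesis
    by blast
qed

lemma weyl_partial_fractions:
  "\<exists>A M1 C. \<forall>\<nu>. det (D \<nu>) \<noteq> 0 \<longrightarrow>
    W \<nu> = A + \<nu> \<cdot> M1 + (\<Sum>a | det (D a) = 0. (1 / (a - \<nu>)) \<cdot> C a)"
proof -
  obtain p where p: "\<And>\<nu>. det (D \<nu>) = poly p \<nu>"
    using polyfun_det[OF polyfun_D] by (auto simp: polyfun_def)
  have nonreal: "poly p z \<noteq> 0" if "z \<notin> \<real>" for z
    using det_D_nonzero[OF that] unfolding p .
  then have p0: "p \<noteq> 0"
    by (metis complex_is_Real_iff imaginary_unit.sel(2) poly_0 zero_neq_one)
  have "\<exists>c0 c1 c. \<forall>z. poly p z \<noteq> 0 \<longrightarrow>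
      W z $ i $ j = c0 + z * c1 + (\<Sum>a | poly p a = 0. c a / (a - z))" for i j
  proof -
    obtain q where q: "\<And>\<nu>. poly p \<nu> \<noteq> 0 \<Longrightarrow> W \<nu> $ i $ j * poly p \<nu> = poly q \<nu>"
      using weyl_rational[of i j] unfolding p by blast
    obtain K where K: "\<And>\<nu>. \<nu> \<notin> \<real> \<Longrightarrow> cmod (W \<nu> $ i $ j) \<le> K * (1 + (cmod (\<nu> + \<i>))\<^sup>2 / \<bar>Im \<nu>\<bar>)"
      using weyl_bound[of i j] by blast
    show ?thesis
      using nonreal by (intro partial_fractions_if_bounded[OF p0 _ q K]) auto
  qed
  then have "\<forall>i j. \<exists>c0 c1 c. \<forall>z. poly p z \<noteq> 0 \<longrightarrow>
      W z $ i $ j = c0 + z * c1 + (\<Sum>a | poly p a = 0. c a / (a - z))"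
    by blast
  then obtain c0 c1 c where *: "\<forall>i j z. poly p z \<noteq> 0 \<longrightarrow>
      W z $ i $ j = c0 i j + z * c1 i j + (\<Sum>a | poly p a = 0. c i j a / (a - z))"
    unfolding choice_iff by blast
  show ?thesis
    unfolding p
    by (intro exI[of _ "\<chi> i j. c0 i j"] exI[of _ "\<chi> i j. c1 i j"] exI[of _ "\<lambda>a. \<chi> i j. c i j a"])
       (simp add: vec_eq_iff * sum_component)
qed

end

section \<open>Residues and the integral representation\<close>

definition outer_sum :: "(complex^'n) set \<Rightarrow> complex^'n^'n"
  where "outer_sum b = (\<Sum>\<eta>\<in>b. outer \<eta>)"

lemma outer_sum_hadj: "(outer_sum b)\<^sup>\<dagger> = outer_sum b"
  by (simp add: outer_sum_def hadj_sum) (simp add: vec_eq_iff outer_def mult.commute sum_component)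

lemma outer_mv: "outer \<eta> *v x = cdot \<eta> x *s \<eta>"
  by (simp add: vec_eq_iff mv_nth outer_def cdot_def sum_distrib_left mult_ac)

lemma matmul_outer: "A *v \<eta> = 0 \<Longrightarrow> A ** outer \<eta> = 0"
  by (simp add: vec_eq_iff mv_nth matmul_nth outer_def mult.assoc[symmetric] flip: sum_distrib_right)

text \<open>For the \<Omega>-orthonormal basis, \<open>outer_sum b ** \<Omega>\<close> sends each
  basis vector to itself, hence fixes the whole kernel, in particular the columns of
  \<open>C\<close>.\<close>

lemma basis_kernel:
  assumes b: "orthonormal_kernel_basis \<Omega> A (b)"
  shows "A ** outer_sum b = 0" "A ** C = 0 \<Longrightarrow> outer_sum b ** \<Omega> ** C = C"
proof -
  have fin: "finite (b)"
    using b vec.finiteI_independent by (auto simp: orthonormal_kernel_basis_def)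
  have ker: "vec.span (b) = {x. A *v x = 0}"
    using b by (simp add: orthonormal_kernel_basis_def)
  have "A *v \<eta> = 0" if "\<eta> \<in> b" for \<eta>
    using vec.span_base[OF that] ker by auto
  then show "A ** outer_sum b = 0"
    by (simp add: outer_sum_def matmul_sum_right matmul_outer)
  have fix_basis: "(outer_sum b ** \<Omega>) *v \<eta> = \<eta>" if \<eta>: "\<eta> \<in> b" for \<eta>
  proof -
    have "(outer_sum b ** \<Omega>) *v \<eta> = (\<Sum>u\<in>b. cdot u (\<Omega> *v \<eta>) *s u)"
      by (simp add: outer_sum_def mv_sum_left outer_mv flip: matrix_vector_mul_assoc)
    also have "\<dots> = (\<Sum>u\<in>b. if u = \<eta> then \<eta> else 0)"
      using b \<eta> by (intro sum.cong) (auto simp: orthonormal_kernel_basis_def)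
    finally show ?thesis
      using fin \<eta> by simp
  qed
  have fix_kernel: "(outer_sum b ** \<Omega>) *v x = x" if "x \<in> vec.span (b)" for x
    using that
  proof (induction rule: vec.span_induct_alt)
    case base
    then show ?case by simp
  next
    case (step c x y)
    then show ?case
      by (simp add: matrix_vector_right_distrib mv_scale fix_basis)
  qed
  assume "A ** C = 0"
  then have "A *v column j C = 0" for j
    by (simp add: vec_eq_iff mv_nth matmul_nth column_def)
  then have "(outer_sum b ** \<Omega>) *v column j C = column j C" for j
    by (intro fix_kernel) (simp add: ker)
  then show "outer_sum b ** \<Omega> ** C = C"
    by (simp add: vec_eq_iff mv_nth matmul_nth column_def)
qed

context symplectic_system
begin

text \<open>
  The residue \<open>C\<close> at an eigenvalue \<open>a\<close> satisfies \<open>P \<Omega> C = C\<close>, because its columns lie in the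
  kernel, and \<open>P \<Omega> C = P\<close>, by Lagrange's identity for the eigenfunctions and the Weyl solution.
\<close>

lemma residue_eq:
  assumes a: "det (D a) = 0" "a \<in> \<real>"
    and B: "orthonormal_kernel_basis (gram \<Psi> N Zt a) (D a) (B a)"
    and lim: "((\<lambda>\<nu>. (a - \<nu>) \<cdot> W \<nu>) \<longlongrightarrow> C) (at a)"
  shows "C = outer_sum (B a)"
proof -
  have "\<forall>\<^sub>F \<nu> in at a. \<nu> \<notin> {\<nu>. det (D \<nu>) = 0}"
    using finite_eigenvalues by (rule eventually_at_notin_finite)
  then have ev: "\<forall>\<^sub>F \<nu> in at a. det (D \<nu>) \<noteq> 0"
    by eventually_elim simp
  have lin: "((\<lambda>\<nu>. a - \<nu>) \<longlongrightarrow> 0) (at a)"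
    by (rule tendsto_eq_intros refl | simp)+
  have "((\<lambda>\<nu>. D \<nu> ** ((a - \<nu>) \<cdot> W \<nu>)) \<longlongrightarrow> D a ** C) (at a)"
    by (intro tendsto_matmul tendsto_polyfun_matrix polyfun_D lim)
  \<comment> \<open>Away from eigenvalues \<open>D \<nu> ** W \<nu>\<close> is minus a polynomial
    matrix, so the factor \<open>a - \<nu>\<close> sends the product to 0.\<close>
  moreover have "((\<lambda>\<nu>. D \<nu> ** ((a - \<nu>) \<cdot> W \<nu>)) \<longlongrightarrow> 0) (at a)"
  proof -
    have "((\<lambda>\<nu>. (a - \<nu>) \<cdot> (- (\<beta> ** Zh \<nu> (N + 1)))) \<longlongrightarrow> 0 \<cdot> (- (\<beta> ** Zh a (N + 1)))) (at a)"
      by (intro tendsto_mscale lin tendsto_minus tendsto_polyfun_matrix polyfun_\<beta>_Zh)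
    then have "((\<lambda>\<nu>. (a - \<nu>) \<cdot> (- (\<beta> ** Zh \<nu> (N + 1)))) \<longlongrightarrow> 0) (at a)"
      by simp
    then show ?thesis
    proof (rule Lim_transform_eventually)
      show "\<forall>\<^sub>F \<nu> in at a. (a - \<nu>) \<cdot> (- (\<beta> ** Zh \<nu> (N + 1))) = D \<nu> ** ((a - \<nu>) \<cdot> W \<nu>)"
        using ev by eventually_elim (simp only: matmul_mscale_right D_weyl simp_thms not_False_eq_True)
    qed
  qed
  ultimately have DC: "D a ** C = 0"
    using tendsto_unique[OF at_neq_bot] by blast
  \<comment> \<open>Only the \<open>Zt\<close> part of the Weyl solution carries the pole; the
    \<open>Zh\<close> part is polynomial and disappears.\<close>
  have "((\<lambda>\<nu>. (a - \<nu>) \<cdot> X \<nu> k) \<longlongrightarrow> Zt a k ** C) (at a)" if "k \<le> N" for k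
  proof -
    have "((\<lambda>\<nu>. (a - \<nu>) \<cdot> Zh \<nu> k + Zt \<nu> k ** ((a - \<nu>) \<cdot> W \<nu>)) \<longlongrightarrow> 0 \<cdot> Zh a k + Zt a k ** C) (at a)"
      using that
      by (intro tendsto_add tendsto_mscale tendsto_matmul lin lim tendsto_polyfun_matrix
          polyfun_solution[OF Zh] polyfun_solution[OF Zt]) auto
    then show ?thesis
      by (simp add: X_def mscale_add matmul_mscale_right)
  qed
  then have "((\<lambda>\<nu>. outer_sum (B a) ** (\<Sum>k=0..N. (Zt a k)\<^sup>\<dagger> ** \<Psi> k ** ((a - \<nu>) \<cdot> X \<nu> k)))
      \<longlongrightarrow> outer_sum (B a) ** (\<Sum>k=0..N. (Zt a k)\<^sup>\<dagger> ** \<Psi> k ** (Zt a k ** C))) (at a)"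
    by (intro tendsto_matmul tendsto_const tendsto_sum) simp
  moreover have "(\<Sum>k=0..N. (Zt a k)\<^sup>\<dagger> ** \<Psi> k ** (Zt a k ** C)) = gram \<Psi> N Zt a ** C"
    by (induction N) (simp_all add: gram_def matrix_mul_assoc matmul_add_left)
  moreover have "(\<Sum>k=0..N. (Zt a k)\<^sup>\<dagger> ** \<Psi> k ** ((a - \<nu>) \<cdot> X \<nu> k)) = (a - \<nu>) \<cdot> form (Zt a) (X \<nu>)" for \<nu>
    by (simp add: form_def mscale_sum matmul_mscale_right)
  ultimately have lim1: "((\<lambda>\<nu>. outer_sum (B a) ** ((a - \<nu>) \<cdot> form (Zt a) (X \<nu>))) \<longlongrightarrow> outer_sum (B a) ** gram \<Psi> N Zt a ** C) (at a)"
    by (simp add: matrix_mul_assoc)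
  have PD: "outer_sum (B a) ** (D a)\<^sup>\<dagger> = 0"
    using arg_cong[OF basis_kernel(1)[OF B], of hadj] by (simp add: hadj_mult outer_sum_hadj)
  \<comment> \<open>The eigenvalue is real, so \<open>Zt_X_form\<close> applies with factor
    \<open>a - \<nu>\<close>; its boundary term is removed by \<open>PD\<close>, and the expression
    is constant near \<open>a\<close>.\<close>
  have "\<forall>\<^sub>F \<nu> in at a. outer_sum (B a) ** ((a - \<nu>) \<cdot> form (Zt a) (X \<nu>)) = outer_sum (B a)"
    using ev
  proof eventually_elim
    case (elim \<nu>)
    have "cnj a = a"
      using a(2) by (simp add: Reals_cnj_iff)
    with Zt_X_form[OF elim, of a]
    have "outer_sum (B a) ** ((a - \<nu>) \<cdot> form (Zt a) (X \<nu>))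
        = outer_sum (B a) ** (mat 1 + (D a)\<^sup>\<dagger> ** (\<beta> ** JJ ** X \<nu> (N + 1)))"
      by simp
    also have "\<dots> = outer_sum (B a) + outer_sum (B a) ** (D a)\<^sup>\<dagger> ** (\<beta> ** JJ ** X \<nu> (N + 1))"
      by (simp add: matrix_add_ldistrib matrix_mul_assoc)
    finally show ?case
      unfolding PD by simp
  qed
  then have "((\<lambda>\<nu>. outer_sum (B a) ** ((a - \<nu>) \<cdot> form (Zt a) (X \<nu>))) \<longlongrightarrow> outer_sum (B a)) (at a)"
    by (rule tendsto_eventually)
  with lim1 have "outer_sum (B a) ** gram \<Psi> N Zt a ** C = outer_sum (B a)"
    using tendsto_unique[OF at_neq_bot] by blast
  with basis_kernel(2)[OF B DC] show ?thesis
    by simp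
qed

lemma eigenvalue_real: "det (D a) = 0 \<Longrightarrow> a \<in> \<real>"
  using det_D_nonzero by blast

lemma weyl_representation:
  assumes B: "\<And>a. det (D a) = 0 \<Longrightarrow> orthonormal_kernel_basis (gram \<Psi> N Zt a) (D a) (B a)"
  obtains A M1 where "\<And>\<nu>. \<nu> \<notin> \<real> \<Longrightarrow>
    W \<nu> = A + \<nu> \<cdot> M1 + (\<Sum>s | det (D (of_real s)) = 0. (1 / (of_real s - \<nu>)) \<cdot> outer_sum (B (of_real s)))"
proof -
  define R where "R = {a. det (D a) = 0}"
  have finR: "finite R"
    using finite_eigenvalues by (simp add: R_def)
  obtain A M1 C where rep: "\<And>\<nu>. \<nu> \<notin> R \<Longrightarrow>
      W \<nu> = A + \<nu> \<cdot> M1 + (\<Sum>a\<in>R. (1 / (a - \<nu>)) \<cdot> C a)"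
    using weyl_partial_fractions unfolding R_def by blast
  have C: "C a = outer_sum (B a)" if a: "a \<in> R" for a
  proof -
    \<comment> \<open>The remaining summands are regular at \<open>a\<close>, so the factor
      \<open>a - \<nu>\<close> annihilates them in the limit and isolates
      \<open>C a\<close>.\<close>
    have lim: "((\<lambda>\<nu>. (a - \<nu>) \<cdot> (A + \<nu> \<cdot> M1 + (\<Sum>b\<in>R - {a}. (1 / (b - \<nu>)) \<cdot> C b)) + C a)
        \<longlongrightarrow> 0 \<cdot> (A + a \<cdot> M1 + (\<Sum>b\<in>R - {a}. (1 / (b - a)) \<cdot> C b)) + C a) (at a)"
    proof (intro tendsto_add tendsto_mscale tendsto_sum tendsto_const)
      show "((\<lambda>\<nu>. a - \<nu>) \<longlongrightarrow> 0) (at a)"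
        by (rule tendsto_eq_intros refl | simp)+
    qed (auto intro!: tendsto_intros)
    have "((\<lambda>\<nu>. (a - \<nu>) \<cdot> W \<nu>) \<longlongrightarrow> C a) (at a)"
    proof (rule Lim_transform_eventually)
      show "((\<lambda>\<nu>. (a - \<nu>) \<cdot> (A + \<nu> \<cdot> M1 + (\<Sum>b\<in>R - {a}. (1 / (b - \<nu>)) \<cdot> C b)) + C a) \<longlongrightarrow> C a) (at a)"
        using lim by simp
      have "\<forall>\<^sub>F \<nu> in at a. \<nu> \<notin> R"
        using finR by (rule eventually_at_notin_finite)
      then show "\<forall>\<^sub>F \<nu> in at a. (a - \<nu>) \<cdot> (A + \<nu> \<cdot> M1 + (\<Sum>b\<in>R - {a}. (1 / (b - \<nu>)) \<cdot> C b)) + C a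
          = (a - \<nu>) \<cdot> W \<nu>"
      proof eventually_elim
        case (elim \<nu>)
        then have "a - \<nu> \<noteq> 0" using a by auto
        then have "(a - \<nu>) \<cdot> (1 / (a - \<nu>)) \<cdot> C a = C a"
          by (simp add: mscale_mscale) (simp add: vec_eq_iff)
        then show ?case
          using finR a by (simp add: rep[OF elim] sum.remove[of R a] mscale_add)
      qed
    qed
    with a show ?thesis
      by (intro residue_eq B) (auto simp: R_def eigenvalue_real)
  qed
  \<comment> \<open>The spectral function sums over real points; reality of the eigenvalues permits
    this reindexing.\<close>
  have R_eq: "R = of_real ` {s. det (D (of_real s)) = 0}"
    using eigenvalue_real by (force simp: R_def Reals_def)
  have "W \<nu> = A + \<nu> \<cdot> M1 + (\<Sum>s | det (D (of_real s)) = 0. (1 / (of_real s - \<nu>)) \<cdot> outer_sum (B (of_real s)))"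
    if "\<nu> \<notin> \<real>" for \<nu>
  proof -
    have "\<nu> \<notin> R" using that eigenvalue_real by (auto simp: R_def)
    then have "W \<nu> = A + \<nu> \<cdot> M1 + (\<Sum>a\<in>R. (1 / (a - \<nu>)) \<cdot> outer_sum (B a))"
      using rep C by simp
    also have "(\<Sum>a\<in>R. (1 / (a - \<nu>)) \<cdot> outer_sum (B a))
        = (\<Sum>s | det (D (of_real s)) = 0. (1 / (of_real s - \<nu>)) \<cdot> outer_sum (B (of_real s)))"
      unfolding R_eq by (subst sum.reindex) (auto simp: inj_on_def)
    finally show ?thesis .
  qed
  then show thesis
    by (rule that)
qed

text \<open>With the parameters \<nu> and \<open>cnj \<nu>\<close>, the scalar factor in
  \<open>weyl_diff\<close> is 0.\<close>

lemma weyl_hadj: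
  assumes "\<nu> \<notin> \<real>"
  shows "(W \<nu>)\<^sup>\<dagger> = W (cnj \<nu>)"
proof -
  have "cnj \<nu> \<notin> \<real>"
    using assms by (simp add: complex_is_Real_iff)
  then show ?thesis
    using weyl_diff[OF det_D_nonzero[OF assms] det_D_nonzero, of "cnj \<nu>"] by simp
qed

end

text \<open>The hypotheses on \<open>c\<close> leave i and -i. Both half-axes are needed: comparing
  their limits shows that the linear coefficient is Hermitian. On either one a real point
  \<open>s\<close> has distance at least \<mu> from \<open>c * of_real \<mu>\<close>.\<close>

lemma tendsto_imaginary_axis_quotient:
  fixes c :: complex
  assumes c: "Re c = 0" "cmod c = 1" and R: "finite R"
  shows "((\<lambda>\<mu>::real. (1 / (c * of_real \<mu>)) \<cdot>
      (A + (c * of_real \<mu>) \<cdot> M1 + (\<Sum>s\<in>R. (1 / (of_real s - c * of_real \<mu>)) \<cdot> Q s))) \<longlongrightarrow> M1) at_top"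
proof -
  have small: "((\<lambda>\<mu>::real. 1 / (of_real s - c * of_real \<mu>)) \<longlongrightarrow> 0) at_top" for s
  proof (rule Lim_null_comparison)
    show "\<forall>\<^sub>F \<mu> in at_top. norm (1 / (of_real s - c * of_real \<mu>)) \<le> inverse \<mu>"
      using eventually_gt_at_top[of "0::real"]
    proof eventually_elim
      case (elim \<mu>)
      have "\<bar>Im c\<bar> = 1"
        using c by (simp add: cmod_def)
      then have "\<mu> \<le> cmod (of_real s - c * of_real \<mu>)"
        using abs_Im_le_cmod[of "of_real s - c * of_real \<mu>"] elim by (simp add: abs_mult)
      with elim show ?case
        by (simp add: norm_divide inverse_eq_divide frac_le)
    qed
    show "(inverse \<longlongrightarrow> 0) (at_top :: real filter)"
      by (rule tendsto_inverse_0_at_top) (rule filterlim_ident)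
  qed
  have small0: "((\<lambda>\<mu>::real. 1 / (c * of_real \<mu>)) \<longlongrightarrow> 0) at_top"
    using tendsto_minus[OF small[of 0]] by simp
  have lim: "((\<lambda>\<mu>::real. (1 / (c * of_real \<mu>)) \<cdot> (A + (\<Sum>s\<in>R. (1 / (of_real s - c * of_real \<mu>)) \<cdot> Q s)) + M1)
      \<longlongrightarrow> 0 \<cdot> (A + (\<Sum>s\<in>R. 0 \<cdot> Q s)) + M1) at_top"
    by (intro tendsto_add tendsto_mscale tendsto_sum tendsto_const small small0)
  show ?thesis
  proof (rule Lim_transform_eventually)
    show "((\<lambda>\<mu>::real. (1 / (c * of_real \<mu>)) \<cdot> (A + (\<Sum>s\<in>R. (1 / (of_real s - c * of_real \<mu>)) \<cdot> Q s)) + M1)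
      \<longlongrightarrow> M1) at_top"
      using lim by simp
    show "\<forall>\<^sub>F \<mu>::real in at_top.
        (1 / (c * of_real \<mu>)) \<cdot> (A + (\<Sum>s\<in>R. (1 / (of_real s - c * of_real \<mu>)) \<cdot> Q s)) + M1
        = (1 / (c * of_real \<mu>)) \<cdot> (A + (c * of_real \<mu>) \<cdot> M1 + (\<Sum>s\<in>R. (1 / (of_real s - c * of_real \<mu>)) \<cdot> Q s))"
      using eventually_gt_at_top[of "0::real"]
    proof eventually_elim
      case (elim \<mu>)
      then have "c * of_real \<mu> \<noteq> 0"
        using c by auto
      then have "(1 / (c * of_real \<mu>)) \<cdot> (c * of_real \<mu>) \<cdot> M1 = M1"
        by (simp add: mscale_mscale) (simp add: vec_eq_iff)
      then show ?case
        by (simp add: mscale_add algebra_simps)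
    qed
  qed
qed

theorem theorem3p7:
  fixes S \<Psi> :: "nat \<Rightarrow> complex^('n::finite + 'n)^('n + 'n)"
    and N :: nat
    and \<alpha> \<beta> :: "complex^('n + 'n)^'n"
    and Zh Zt :: "complex \<Rightarrow> nat \<Rightarrow> complex^'n^('n + 'n)"
    and B :: "complex \<Rightarrow> (complex^'n) set"
    and E :: "complex set"
    and M :: "complex \<Rightarrow> complex^'n^'n"
    and \<tau> :: "real \<Rightarrow> complex^'n^'n"
  assumes S_symplectic: "\<And>k. k \<le> N \<Longrightarrow> (S k)\<^sup>\<dagger> ** JJ ** S k = JJ"
    and \<Psi>_hermitian: "\<And>k. k \<le> N \<Longrightarrow> (\<Psi> k)\<^sup>\<dagger> = \<Psi> k"
    and \<Psi>_J: "\<And>k. k \<le> N \<Longrightarrow> (\<Psi> k)\<^sup>\<dagger> ** JJ ** \<Psi> k = 0"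
    and \<Psi>_psd: "\<And>k. k \<le> N \<Longrightarrow> psd (\<Psi> k)"
    and \<alpha>: "\<alpha> \<in> \<Gamma>" and \<beta>: "\<beta> \<in> \<Gamma>"
    and Zh: "\<And>\<nu>. mat_solution S \<Psi> N \<nu> (Zh \<nu>)" "\<And>\<nu>. Zh \<nu> 0 = \<alpha>\<^sup>\<dagger>"
    and Zt: "\<And>\<nu>. mat_solution S \<Psi> N \<nu> (Zt \<nu>)" "\<And>\<nu>. Zt \<nu> 0 = - (JJ ** \<alpha>\<^sup>\<dagger>)"
    and Atkinson: "weak_Atkinson \<Psi> N Zt"
    and E_def: "E = {\<nu>. is_eigenvalue S \<Psi> N \<alpha> \<beta> \<nu>}"
    and B: "\<And>\<nu>. \<nu> \<in> E \<Longrightarrow>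
      orthonormal_kernel_basis (gram \<Psi> N Zt \<nu>) (\<beta> ** Zt \<nu> (N + 1)) (B \<nu>)"
    and \<tau>_def: "\<tau> = spectral_fun E B"
    and M_def: "M = weyl_M N \<beta> Zh Zt"
  shows "\<exists>M1.
    ((\<lambda>\<mu>::real. (1 / (\<i> * of_real \<mu>)) \<cdot> M (\<i> * of_real \<mu>)) \<longlongrightarrow> M1) at_top \<and>
    psd M1 \<and>
    (\<forall>\<nu>. \<nu> \<notin> \<real> \<longrightarrow>
      (\<exists>I. has_RS_integral_mat (\<lambda>t. of_real (Im (inverse (of_real t - \<nu>)))) \<tau> I \<and>
           ImM (M \<nu>) = of_real (Im \<nu>) \<cdot> M1 + I)) \<and>
    (\<forall>\<nu>. \<nu> \<notin> \<real> \<longrightarrow>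
      (\<exists>I. has_RS_integral_mat
             (\<lambda>t. 1 / (of_real t - \<nu>) - of_real (t / (1 + t\<^sup>2))) \<tau> I \<and>
           M \<nu> = ReM (M \<i>) + \<nu> \<cdot> M1 + I))"
proof -
  interpret symplectic_system S \<Psi> N \<alpha> \<beta> Zh Zt
    by unfold_locales (fact S_symplectic \<Psi>_psd \<Psi>_J \<alpha> \<beta> Zh Zt Atkinson)+
  have E_det: "\<nu> \<in> E \<longleftrightarrow> det (D \<nu>) = 0" for \<nu>
    by (simp add: E_def is_eigenvalue_iff_det)
  define R where "R = {s::real. of_real s \<in> E}"
  define Q where "Q s = (\<Sum>\<eta>\<in>B (complex_of_real s). outer \<eta>)" for s
  have finR: "finite R"
  proof (rule finite_subset)
    show "R \<subseteq> Re ` {\<nu>. det (D \<nu>) = 0}"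
      by (force simp: R_def E_det)
  qed (intro finite_imageI finite_eigenvalues)
  have Q_hadj: "(Q s)\<^sup>\<dagger> = Q s" for s
    using outer_sum_hadj by (simp add: outer_sum_def Q_def)
  obtain A M1 where rep: "\<And>\<nu>. \<nu> \<notin> \<real> \<Longrightarrow> M \<nu> = A + \<nu> \<cdot> M1 + (\<Sum>s\<in>R. (1 / (of_real s - \<nu>)) \<cdot> Q s)"
    using weyl_representation[of B] B by (auto simp: M_def R_def Q_def outer_sum_def E_det)
  have nonreal: "c * of_real \<mu> \<notin> \<real>" if "Re c = 0" "cmod c = 1" "\<mu> > 0" for c \<mu>
    using that by (auto simp: complex_is_Real_iff cmod_def)
  have limit: "((\<lambda>\<mu>::real. (1 / (c * of_real \<mu>)) \<cdot> M (c * of_real \<mu>)) \<longlongrightarrow> M1) at_top"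
    if c: "Re c = 0" "cmod c = 1" for c
  proof (rule Lim_transform_eventually[OF tendsto_imaginary_axis_quotient[OF c finR]])
    show "\<forall>\<^sub>F \<mu>::real in at_top. (1 / (c * of_real \<mu>)) \<cdot> (A + (c * of_real \<mu>) \<cdot> M1
        + (\<Sum>s\<in>R. (1 / (of_real s - c * of_real \<mu>)) \<cdot> Q s)) = (1 / (c * of_real \<mu>)) \<cdot> M (c * of_real \<mu>)"
      using eventually_gt_at_top[of "0::real"] by eventually_elim (simp add: rep nonreal c)
  qed
  have limit_i: "((\<lambda>\<mu>::real. (1 / (\<i> * of_real \<mu>)) \<cdot> M (\<i> * of_real \<mu>)) \<longlongrightarrow> M1) at_top"
    by (rule limit) auto
  have M_hadj: "(M \<nu>)\<^sup>\<dagger> = M (cnj \<nu>)" if "\<nu> \<notin> \<real>" for \<nu>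
    unfolding M_def using that by (rule weyl_hadj)
  \<comment> \<open>Taking adjoints reflects the upper imaginary axis into the lower one.\<close>
  have "((\<lambda>\<mu>::real. ((1 / (\<i> * of_real \<mu>)) \<cdot> M (\<i> * of_real \<mu>))\<^sup>\<dagger>) \<longlongrightarrow> M1) at_top"
  proof (rule Lim_transform_eventually)
    show "((\<lambda>\<mu>::real. (1 / (- \<i> * of_real \<mu>)) \<cdot> M (- \<i> * of_real \<mu>)) \<longlongrightarrow> M1) at_top"
      by (rule limit) auto
    show "\<forall>\<^sub>F \<mu>::real in at_top. (1 / (- \<i> * of_real \<mu>)) \<cdot> M (- \<i> * of_real \<mu>)
        = ((1 / (\<i> * of_real \<mu>)) \<cdot> M (\<i> * of_real \<mu>))\<^sup>\<dagger>"
      using eventually_gt_at_top[of "0::real"]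
      by eventually_elim (simp add: hadj_mscale M_hadj nonreal)
  qed
  then have M1_hadj: "M1\<^sup>\<dagger> = M1"
    using tendsto_hadj[OF limit_i] tendsto_unique trivial_limit_at_top_linorder by blast
  \<comment> \<open>The quotient need not be Hermitian before the limit; its Hermitian part has the
    same limit and is positive semidefinite.\<close>
  have "((\<lambda>\<mu>::real. (1 / 2) \<cdot> ((1 / (\<i> * of_real \<mu>)) \<cdot> M (\<i> * of_real \<mu>)
      + ((1 / (\<i> * of_real \<mu>)) \<cdot> M (\<i> * of_real \<mu>))\<^sup>\<dagger>)) \<longlongrightarrow> (1 / 2) \<cdot> (M1 + M1\<^sup>\<dagger>)) at_top"
    by (intro tendsto_mscale tendsto_add tendsto_const tendsto_hadj limit_i)
  moreover have "(1 / 2) \<cdot> (M1 + M1\<^sup>\<dagger>) = M1"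
    by (simp add: M1_hadj) (simp add: vec_eq_iff)
  ultimately have limit_Re: "((\<lambda>\<mu>::real. (1 / 2) \<cdot> ((1 / (\<i> * of_real \<mu>)) \<cdot> M (\<i> * of_real \<mu>)
      + ((1 / (\<i> * of_real \<mu>)) \<cdot> M (\<i> * of_real \<mu>))\<^sup>\<dagger>)) \<longlongrightarrow> M1) at_top"
    by simp
  have M1_psd: "psd M1"
  proof (rule psd_limit[OF limit_Re])
    show "\<forall>\<^sub>F \<mu>::real in at_top. psd ((1 / 2) \<cdot> ((1 / (\<i> * of_real \<mu>)) \<cdot> M (\<i> * of_real \<mu>)
      + ((1 / (\<i> * of_real \<mu>)) \<cdot> M (\<i> * of_real \<mu>))\<^sup>\<dagger>))"
      using eventually_gt_at_top[of "0::real"]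
    proof eventually_elim
      case (elim \<mu>)
      define \<nu> where "\<nu> = \<i> * complex_of_real \<mu>"
      have d: "det (D \<nu>) \<noteq> 0"
        using elim by (intro det_D_nonzero) (simp add: \<nu>_def nonreal)
      have \<nu>: "\<nu> - cnj \<nu> = 2 * \<nu>" "cnj \<nu> = - \<nu>" "\<nu> \<noteq> 0"
        using elim by (simp_all add: \<nu>_def)
      \<comment> \<open>As \<open>cnj \<nu> = - \<nu>\<close>, the adjoint enters with a minus sign,
        and Lagrange's identity identifies the result as the energy of the Weyl solution.\<close>
      have "(1 / 2) \<cdot> ((1 / \<nu>) \<cdot> M \<nu> + ((1 / \<nu>) \<cdot> M \<nu>)\<^sup>\<dagger>) = (1 / (2 * \<nu>)) \<cdot> (M \<nu> - (M \<nu>)\<^sup>\<dagger>)"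
        by (simp add: vec_eq_iff \<nu>(2) right_diff_distrib)
      also have "\<dots> = form (X \<nu>) (X \<nu>)"
        unfolding M_def weyl_diff[OF d d] \<nu>(1) mscale_mscale using \<nu>(3) by (simp add: vec_eq_iff)
      finally show ?case
        by (simp add: \<nu>_def psd_form)
    qed
  qed simp
  have i: "\<i> \<notin> \<real>" "cnj \<i> \<notin> \<real>"
    by (simp_all add: complex_is_Real_iff)
  have M_nth: "M \<nu> $ p $ q = A $ p $ q + \<nu> * M1 $ p $ q + (\<Sum>s\<in>R. 1 / (of_real s - \<nu>) * Q s $ p $ q)"
    if "\<nu> \<notin> \<real>" for \<nu> p q
    by (simp add: rep[OF that] sum_component)
  have cnj_nth: "cnj (M1 $ q $ p) = M1 $ p $ q" "cnj (Q s $ q $ p) = Q s $ p $ q" for s p q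
    using M1_hadj Q_hadj[of s] by (metis hadj_nth)+
  \<comment> \<open>Comparing the representation at i and -i shows that the constant term is
    Hermitian too.\<close>
  have cnj_A: "cnj (A $ q $ p) = A $ p $ q" for p q
    using arg_cong[OF M_hadj[OF i(1)], of "\<lambda>K. K $ p $ q"] M_nth[OF i(1), of q p] M_nth[OF i(2), of p q]
    by (simp add: cnj_nth)
  have cnj_M: "cnj (M \<nu> $ q $ p)
      = A $ p $ q + cnj \<nu> * M1 $ p $ q + (\<Sum>s\<in>R. 1 / (of_real s - cnj \<nu>) * Q s $ p $ q)"
    if "\<nu> \<notin> \<real>" for \<nu> p q
    by (simp add: M_nth[OF that] cnj_A cnj_nth)
  have RS: "has_RS_integral_mat f \<tau> (\<Sum>s\<in>R. f s \<cdot> Q s)" if "\<And>s. isCont f s" for f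
    unfolding \<tau>_def R_def Q_def using finR that
    by (intro has_RS_integral_mat_spectral_fun) (simp_all add: R_def)
  have ne: "complex_of_real s - \<nu> \<noteq> 0" if "\<nu> \<notin> \<real>" for s \<nu>
    using that by auto
  have Im_part: "ImM (M \<nu>) = of_real (Im \<nu>) \<cdot> M1 + (\<Sum>s\<in>R. of_real (Im (inverse (of_real s - \<nu>))) \<cdot> Q s)"
    if \<nu>: "\<nu> \<notin> \<real>" for \<nu>
  proof -
    have *: "1 / (2 * \<i>) * (z - cnj z) = of_real (Im z)" for z
      by (simp add: complex_eq_iff)
    have "ImM (M \<nu>) $ p $ q = 1 / (2 * \<i>) * (\<nu> - cnj \<nu>) * M1 $ p $ q
        + (\<Sum>s\<in>R. 1 / (2 * \<i>) * (1 / (of_real s - \<nu>) - cnj (1 / (of_real s - \<nu>))) * Q s $ p $ q)" for p q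
    proof -
      have "ImM (M \<nu>) $ p $ q = 1 / (2 * \<i>) * (M \<nu> $ p $ q - cnj (M \<nu> $ q $ p))"
        by (simp add: ImM_def)
      then show ?thesis
        unfolding cnj_M[OF \<nu>] M_nth[OF \<nu>]
        by (simp add: left_diff_distrib right_diff_distrib sum_subtractf sum_distrib_left
            diff_divide_distrib add_divide_distrib sum_divide_distrib distrib_left cnj_A cnj_nth
            sum_negf mult.assoc)
    qed
    then show ?thesis
      by (simp only: * vec_eq_iff) (simp add: sum_component inverse_eq_divide)
  qed
  have full: "M \<nu> = ReM (M \<i>) + \<nu> \<cdot> M1
      + (\<Sum>s\<in>R. (1 / (of_real s - \<nu>) - of_real (s / (1 + s\<^sup>2))) \<cdot> Q s)" if \<nu>: "\<nu> \<notin> \<real>" for \<nu>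
  proof -
    \<comment> \<open>The origin of the compensating term in the kernel: it is the real part of 1 /
      (s - i). Since \<open>M1\<close> is Hermitian, \<open>\<i> \<cdot> M1\<close> contributes
      nothing to \<open>ReM (M \<i>)\<close>.\<close>
    have *: "1 / 2 * (1 / (of_real s - \<i>) + 1 / (of_real s - cnj \<i>)) = complex_of_real (s / (1 + s\<^sup>2))" for s
    proof -
      have "(of_real s - \<i>) * (of_real s - cnj \<i>) = complex_of_real (1 + s\<^sup>2)"
        by (simp add: algebra_simps power2_eq_square)
      moreover have "complex_of_real (1 + s\<^sup>2) \<noteq> 0"
        by (metis add_pos_nonneg less_irrefl of_real_eq_0_iff zero_le_power2 zero_less_one)
      ultimately show ?thesis
        using ne[OF i(1), of s] ne[OF i(2), of s]
        by (simp add: field_simps del: of_real_add of_real_power)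
    qed
    have "ReM (M \<i>) $ p $ q
        = A $ p $ q + (\<Sum>s\<in>R. 1 / 2 * (1 / (of_real s - \<i>) + 1 / (of_real s - cnj \<i>)) * Q s $ p $ q)" for p q
    proof -
      have "ReM (M \<i>) $ p $ q = 1 / 2 * (M \<i> $ p $ q + cnj (M \<i> $ q $ p))"
        by (simp add: ReM_def)
      then show ?thesis
        unfolding cnj_M[OF i(1)] M_nth[OF i(1)]
        by (simp add: distrib_right distrib_left sum.distrib sum_distrib_left add_divide_distrib
            sum_divide_distrib cnj_A cnj_nth)
    qed
    then have "ReM (M \<i>) $ p $ q = A $ p $ q + (\<Sum>s\<in>R. complex_of_real (s / (1 + s\<^sup>2)) * Q s $ p $ q)" for p q
      by (simp only: *)
    then show ?thesis
      by (simp add: vec_eq_iff M_nth[OF \<nu>] sum_component left_diff_distrib sum_subtractf)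
  qed
  show ?thesis
  proof (rule exI[of _ M1], intro conjI allI impI)
    fix \<nu> :: complex assume \<nu>: "\<nu> \<notin> \<real>"
    have "isCont (\<lambda>t. inverse (complex_of_real t - \<nu>)) s" for s
      using ne[OF \<nu>, of s] by (intro continuous_intros)
    then have "isCont (\<lambda>t. complex_of_real (Im (inverse (of_real t - \<nu>)))) s" for s
      by (intro continuous_of_real isCont_Im)
    with Im_part[OF \<nu>] RS show "\<exists>I. has_RS_integral_mat (\<lambda>t. of_real (Im (inverse (of_real t - \<nu>)))) \<tau> I \<and>
        ImM (M \<nu>) = of_real (Im \<nu>) \<cdot> M1 + I"
      by blast
    have "isCont (\<lambda>t. 1 / (of_real t - \<nu>) - complex_of_real (t / (1 + t\<^sup>2))) s" for s
      using ne[OF \<nu>, of s] by (intro continuous_intros) (auto simp: add_nonneg_eq_0_iff)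
    with full[OF \<nu>] RS show "\<exists>I. has_RS_integral_mat
        (\<lambda>t. 1 / (of_real t - \<nu>) - of_real (t / (1 + t\<^sup>2))) \<tau> I \<and> M \<nu> = ReM (M \<i>) + \<nu> \<cdot> M1 + I"
      by blast
  qed (fact limit_i M1_psd)+
qed

end
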